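(* Let $\mathbf{d}$ be a Turing degree and let $\mathcal{M}$ be a computable structure such that $\mathbf{d}$ is the degree of categoricity of $\mathcal{M}$, and such that $\mathbf{d}$ is not the strong degree of categoricity of any computable structure. Then $\mathcal{M}$ has infinite spectral dimension, $\mathcal{M}$ has an infinite automorphism group, and there are computable copies $\mathcal{A}$ and $\mathcal{B}$ of $\mathcal{M}$ such that $\mathrm{IsoSpec}(\mathcal{A},\mathcal{B})$ is not finitely generated.
   Context: For computable structures $\mathcal{A}\cong\mathcal{B}$, $\mathrm{IsoSpec}(\mathcal{A},\mathcal{B})$ is the set of Turing degrees that compute some isomorphism $f:\mathcal{A}\cong\mathcal{B}$. A computable structure $\mathcal{A}$ is $\mathbf{d}$-computably categorical if $\mathbf{d}\in\mathrm{IsoSpec}(\mathcal{A},\mathcal{B})$ for every computable copy $\mathcal{B}$ of $\mathcal{A}$; $\mathrm{CatSpec}(\mathcal{A})$ is the set of degrees $\mathbf{d}$ for which $\mathcal{A}$ is $\mathbf{d}$-computably categorical. $\mathbf{d}$ is the degree of categoricity of $\mathcal{A}$ if $\mathrm{CatSpec}(\mathcal{A})$ equals the cone $\{\mathbf{c}:\mathbf{c}\geq_T\mathbf{d}\}$. If $\{(\mathcal{A}_i,\mathcal{B}_i)\}_{i<\omega}$ lists all pairs of computable copies of $\mathcal{M}$, the spectral dimension of $\mathcal{M}$ is the least $k\leq\omega$ such that there is $X\subseteq\omega$ with $|X|=k$ and $\mathrm{CatSpec}(\mathcal{M})=\bigcap_{i\in X}\mathrm{IsoSpec}(\mathcal{A}_i,\mathcal{B}_i)$.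 A structure has strong degree of categoricity $\mathbf{d}$ if it has degree of categoricity $\mathbf{d}$ and spectral dimension $1$. An upward-closed set $\mathcal{Z}$ of Turing degrees is finitely generated if it is a union of finitely many cones $\{\mathbf{c}:\mathbf{c}\geq_T\mathbf{d}\}$. *)

theory Defs
  imports "HOL-Algebra.Bij" "HOL-Library.Nat_Bijection" "HOL-Library.Countable_Set"
    "HOL-Library.Extended_Nat"
begin

section \<open>Computability relative to an oracle\<close>

text \<open>
  Kleene's partial recursive functions with an additional basic function, the characteristic
  function of the oracle. Programs carry no arity. A basic function ignores superfluous arguments
  and is undefined when an argument that it needs is missing.
\<close>

datatype recf =
    Zero
  | Succ
  | Proj nat
  | Query
  | Comp recf "recf list"
  | PRec recf recf
  | Mu recf

instance recf :: countable
  by countable_datatype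

text \<open>\<open>eval X p xs y\<close>: with oracle \<open>X\<close>, program \<open>p\<close> halts on input \<open>xs\<close> with output \<open>y\<close>.\<close>

inductive eval :: "nat set \<Rightarrow> recf \<Rightarrow> nat list \<Rightarrow> nat \<Rightarrow> bool" for X :: "nat set" where
  Zero: "eval X Zero xs 0"
| Succ: "eval X Succ (x # xs) (Suc x)"
| Proj: "i < length xs \<Longrightarrow> eval X (Proj i) xs (xs ! i)"
| Query: "eval X Query (x # xs) (of_bool (x \<in> X))"
| Comp: "length ys = length gs \<Longrightarrow> (\<And>i. i < length gs \<Longrightarrow> eval X (gs ! i) xs (ys ! i)) \<Longrightarrow>
    eval X p ys z \<Longrightarrow> eval X (Comp p gs) xs z"
| PRec_0: "eval X p xs y \<Longrightarrow> eval X (PRec p q) (0 # xs) y"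
| PRec_Suc: "eval X (PRec p q) (n # xs) r \<Longrightarrow> eval X q (r # n # xs) y \<Longrightarrow>
    eval X (PRec p q) (Suc n # xs) y"
| Mu: "eval X p (n # xs) 0 \<Longrightarrow> (\<And>m. m < n \<Longrightarrow> \<exists>k. eval X p (m # xs) (Suc k)) \<Longrightarrow>
    eval X (Mu p) xs n"

definition computes :: "nat set \<Rightarrow> (nat \<Rightarrow> nat) \<Rightarrow> bool" where
  "computes X f \<longleftrightarrow> (\<exists>p. \<forall>n. eval X p [n] (f n))"

definition computable :: "(nat \<Rightarrow> nat) \<Rightarrow> bool" where
  "computable f \<longleftrightarrow> computes {} f"

definition computable_set :: "nat set \<Rightarrow> bool" where
  "computable_set S \<longleftrightarrow> computable (\<lambda>n. of_bool (n \<in> S))"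

definition turing_le :: "nat set \<Rightarrow> nat set \<Rightarrow> bool" where
  "turing_le X Y \<longleftrightarrow> computes Y (\<lambda>n. of_bool (n \<in> X))"

lemma eval_deterministic: "eval X p xs y \<Longrightarrow> eval X p xs z \<Longrightarrow> y = z"
proof (induction arbitrary: z rule: eval.induct)
  case (Comp ys gs xs p y)
  from Comp.prems obtain zs where zs: "length zs = length gs"
    "\<And>i. i < length gs \<Longrightarrow> eval X (gs ! i) xs (zs ! i)" "eval X p zs z"
    by (cases rule: eval.cases) auto
  have "ys = zs"
    using Comp.hyps(1) Comp.IH(1) zs by (intro nth_equalityI) auto
  then show ?case using Comp.IH(2) zs(3) by blast
next
  case (PRec_Suc p q n xs r y)
  from PRec_Suc.prems show ?case
    by (cases rule: eval.cases) (use PRec_Suc.IH in blast)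
next
  case (Mu p n xs)
  from Mu.prems obtain z0: "eval X p (z # xs) 0"
    and zS: "\<And>m. m < z \<Longrightarrow> \<exists>k. eval X p (m # xs) (Suc k)"
    by (cases rule: eval.cases) auto
  show ?case
  proof (rule linorder_cases[of n z])
    assume "n < z"
    then show ?thesis using zS Mu.IH(1) by blast
  next
    assume "z < n"
    then show ?thesis using z0 Mu.IH(2) by blast
  qed
qed (erule eval.cases; simp)+

fun relativize :: "recf \<Rightarrow> recf \<Rightarrow> recf" where
  "relativize q Query = Comp q [Proj 0]"
| "relativize q (Comp p gs) = Comp (relativize q p) (map (relativize q) gs)"
| "relativize q (PRec p p') = PRec (relativize q p) (relativize q p')"
| "relativize q (Mu p) = Mu (relativize q p)"
| "relativize q p = p"

lemma eval_relativize:
  assumes q: "\<And>n. eval Y q [n] (of_bool (n \<in> X))"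
  shows "eval X p xs y \<Longrightarrow> eval Y (relativize q p) xs y"
proof (induction rule: eval.induct)
  case (Query x xs)
  have "eval Y (Proj 0) (x # xs) x"
    using eval.Proj[of 0 "x # xs" Y] by simp
  then show ?case
    using eval.Comp[of "[x]" "[Proj 0]" Y "x # xs" q] q by simp
next
  case (Mu p n xs)
  then show ?case using eval.Mu[of Y "relativize q p"] by (metis relativize.simps(4))
qed (auto intro: eval.intros)

lemma computes_mono: "computes X f \<Longrightarrow> turing_le X Y \<Longrightarrow> computes Y f"
  unfolding computes_def turing_le_def by (meson eval_relativize)

lemma turing_le_refl: "turing_le X X"
  unfolding turing_le_def computes_def by (blast intro: eval.Query)

lemma turing_le_trans: "turing_le X Y \<Longrightarrow> turing_le Y Z \<Longrightarrow> turing_le X Z"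
  using computes_mono unfolding turing_le_def by blast


section \<open>Turing degrees\<close>

definition turing_equiv :: "nat set \<Rightarrow> nat set \<Rightarrow> bool" where
  "turing_equiv X Y \<longleftrightarrow> turing_le X Y \<and> turing_le Y X"

quotient_type turing_degree = "nat set" / turing_equiv
proof (rule equivpI)
  show "reflp turing_equiv"
    by (auto intro: reflpI simp: turing_equiv_def turing_le_refl)
  show "symp turing_equiv"
    by (auto intro: sympI simp: turing_equiv_def)
  show "transp turing_equiv"
    by (rule transpI) (use turing_le_trans in \<open>auto simp: turing_equiv_def\<close>)
qed

instantiation turing_degree :: order
begin

lift_definition less_eq_turing_degree :: "turing_degree \<Rightarrow> turing_degree \<Rightarrow> bool" is turing_le
  unfolding turing_equiv_def using turing_le_trans by blast

definition less_turing_degree :: "turing_degree \<Rightarrow> turing_degree \<Rightarrow> bool" where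
  "less_turing_degree c d \<longleftrightarrow> c \<le> d \<and> \<not> d \<le> c"

instance
proof
  fix c d e :: turing_degree
  show "c < d \<longleftrightarrow> c \<le> d \<and> \<not> d \<le> c" by (rule less_turing_degree_def)
  show "c \<le> c" by transfer (rule turing_le_refl)
  show "c \<le> d \<Longrightarrow> d \<le> e \<Longrightarrow> c \<le> e" by transfer (rule turing_le_trans)
  show "c \<le> d \<Longrightarrow> d \<le> c \<Longrightarrow> c = d" by transfer (simp add: turing_equiv_def)
qed

end

lift_definition degree_computes :: "turing_degree \<Rightarrow> (nat \<Rightarrow> nat) \<Rightarrow> bool" is computes
  unfolding turing_equiv_def using computes_mono by blast

definition finitely_generated :: "turing_degree set \<Rightarrow> bool" where
  "finitely_generated Z \<longleftrightarrow> (\<exists>D. finite D \<and> Z = (\<Union>d\<in>D. {d..}))"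


section \<open>Computable structures\<close>

text \<open>
  A structure comes with its language. Relation and function symbols are natural numbers, and the
  partial arity maps are defined exactly on the symbols of the language; constants are function
  symbols of arity 0.
\<close>

record struct =
  universe :: "nat set"
  rel_arity :: "nat \<rightharpoonup> nat"
  fun_arity :: "nat \<rightharpoonup> nat"
  rel_interp :: "nat \<Rightarrow> nat list set"
  fun_interp :: "nat \<Rightarrow> nat list \<rightharpoonup> nat"

definition tuples :: "nat set \<Rightarrow> nat \<Rightarrow> nat list set" where
  "tuples U n = {xs. set xs \<subseteq> U \<and> length xs = n}"

text \<open>
  Interpretations carry no information outside the language and the universe, so that
  well-formed structures are equal as records only if they are the same structure.
\<close>

definition wf_struct :: "struct \<Rightarrow> bool" where
  "wf_struct A \<longleftrightarrow> universe A \<noteq> {} \<and>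
    (\<forall>i. case rel_arity A i of
        None \<Rightarrow> rel_interp A i = {}
      | Some n \<Rightarrow> rel_interp A i \<subseteq> tuples (universe A) n) \<and>
    (\<forall>i. case fun_arity A i of
        None \<Rightarrow> fun_interp A i = Map.empty
      | Some n \<Rightarrow> dom (fun_interp A i) = tuples (universe A) n \<and>
                  ran (fun_interp A i) \<subseteq> universe A)"

primrec option_encode :: "nat option \<Rightarrow> nat" where
  "option_encode None = 0"
| "option_encode (Some n) = Suc n"

text \<open>
  The language and the universe are computable, and the relations and functions are computable
  uniformly in their symbols.
\<close>

definition computable_struct :: "struct \<Rightarrow> bool" where
  "computable_struct A \<longleftrightarrow> wf_struct A \<and>
    computable_set (universe A) \<and>
    computable (\<lambda>i. option_encode (rel_arity A i)) \<and>
    computable (\<lambda>i. option_encode (fun_arity A i)) \<and>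
    computable_set {prod_encode (i, list_encode xs) | i xs. xs \<in> rel_interp A i} \<and>
    computable (\<lambda>n. case prod_decode n of
      (i, c) \<Rightarrow> option_encode (fun_interp A i (list_decode c)))"

text \<open>
  Isomorphisms take the value \<open>undefined\<close> outside the universe, hence are
  determined by their values on it. Since \<open>undefined\<close> is one fixed number, for computable
  structures this extension to a total function does not affect which oracles compute
  the isomorphism.
\<close>

definition struct_iso :: "(nat \<Rightarrow> nat) \<Rightarrow> struct \<Rightarrow> struct \<Rightarrow> bool" where
  "struct_iso f A B \<longleftrightarrow> f \<in> extensional (universe A) \<and>
    bij_betw f (universe A) (universe B) \<and>
    rel_arity A = rel_arity B \<and> fun_arity A = fun_arity B \<and>
    (\<forall>i n. rel_arity A i = Some n \<longrightarrow>
      (\<forall>xs\<in>tuples (universe A) n. xs \<in> rel_interp A i \<longleftrightarrow> map f xs \<in> rel_interp B i)) \<and>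
    (\<forall>i n. fun_arity A i = Some n \<longrightarrow>
      (\<forall>xs\<in>tuples (universe A) n.
        fun_interp B i (map f xs) = map_option f (fun_interp A i xs)))"

definition isomorphic :: "struct \<Rightarrow> struct \<Rightarrow> bool" where
  "isomorphic A B \<longleftrightarrow> (\<exists>f. struct_iso f A B)"

definition AutGroup :: "struct \<Rightarrow> (nat \<Rightarrow> nat) monoid" where
  "AutGroup A = (BijGroup (universe A))\<lparr>carrier := {f. struct_iso f A A}\<rparr>"

definition computable_copies :: "struct \<Rightarrow> struct set" where
  "computable_copies A = {B. computable_struct B \<and> isomorphic A B}"


section \<open>Categoricity spectra and spectral dimension\<close>

definition IsoSpec :: "struct \<Rightarrow> struct \<Rightarrow> turing_degree set" where
  "IsoSpec A B = {d. \<exists>f. struct_iso f A B \<and> degree_computes d f}"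

definition computably_categorical :: "turing_degree \<Rightarrow> struct \<Rightarrow> bool" where
  "computably_categorical d A \<longleftrightarrow> (\<forall>B\<in>computable_copies A. d \<in> IsoSpec A B)"

definition CatSpec :: "struct \<Rightarrow> turing_degree set" where
  "CatSpec A = {d. computably_categorical d A}"

definition degree_of_categoricity :: "struct \<Rightarrow> turing_degree \<Rightarrow> bool" where
  "degree_of_categoricity A d \<longleftrightarrow> CatSpec A = {d..}"

definition lists_copy_pairs :: "(nat \<Rightarrow> struct \<times> struct) \<Rightarrow> struct \<Rightarrow> bool" where
  "lists_copy_pairs P M \<longleftrightarrow> range P = computable_copies M \<times> computable_copies M"

definition cardinality :: "nat set \<Rightarrow> enat" where
  "cardinality X = (if finite X then enat (card X) else \<infinity>)"

text \<open>
  The index set \<open>X\<close> is required to be nonempty. Otherwise a computably categorical structure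
  would have dimension 0 (an empty intersection being the set of all degrees), and \<open>0\<close> would not
  be the strong degree of categoricity of any structure. The dimension does not depend on the
  choice of the listing \<open>P\<close>, and a listing exists for every computable \<open>M\<close>.
\<close>

definition spectral_dimension :: "struct \<Rightarrow> enat" where
  "spectral_dimension M = (LEAST k. \<exists>P X. lists_copy_pairs P M \<and> X \<noteq> {} \<and> cardinality X = k \<and>
    CatSpec M = (\<Inter>i\<in>X. IsoSpec (fst (P i)) (snd (P i))))"

definition strong_degree_of_categoricity :: "struct \<Rightarrow> turing_degree \<Rightarrow> bool" where
  "strong_degree_of_categoricity A d \<longleftrightarrow>
    degree_of_categoricity A d \<and> spectral_dimension A = 1"


subsection \<open>Existence of listings\<close>

lemma countable_computable: "countable (Collect computable)"
proof -
  have "\<exists>p. \<forall>n. eval {} p [n] (f n)" if "computable f" for f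
    using that by (simp add: computable_def computes_def)
  then obtain prog where prog: "\<And>f n. computable f \<Longrightarrow> eval {} (prog f) [n] (f n)"
    by metis
  have "inj_on prog (Collect computable)"
  proof (rule inj_onI)
    fix f g assume "f \<in> Collect computable" "g \<in> Collect computable" "prog f = prog g"
    then show "f = g" using prog eval_deterministic by (metis ext mem_Collect_eq)
  qed
  then show ?thesis by (rule countableI')
qed

lemma countable_computable_struct: "countable (Collect computable_struct)"
proof -
  define code where "code = (\<lambda>A :: struct.
    ((\<lambda>n. of_bool (n \<in> universe A) :: nat),
     (\<lambda>i. option_encode (rel_arity A i)),
     (\<lambda>i. option_encode (fun_arity A i)),
     (\<lambda>n. of_bool (n \<in> {prod_encode (i, list_encode xs) | i xs. xs \<in> rel_interp A i}) :: nat),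
     (\<lambda>n. case prod_decode n of (i, c) \<Rightarrow> option_encode (fun_interp A i (list_decode c)))))"
  have opt: "a = b" if "option_encode a = option_encode b" for a b
    using that by (cases a; cases b) simp_all
  have "inj_on code (Collect computable_struct)"
  proof (rule inj_onI)
    fix A B assume eq: "code A = code B"
    have 1: "universe A = universe B"
    proof -
      have "(\<lambda>n. of_bool (n \<in> universe A) :: nat) = (\<lambda>n. of_bool (n \<in> universe B))"
        using eq unfolding code_def prod.inject by (elim conjE)
      then show ?thesis by (auto simp: fun_eq_iff of_bool_eq_iff)
    qed
    have "(\<lambda>i. option_encode (rel_arity A i)) = (\<lambda>i. option_encode (rel_arity B i))"
      using eq unfolding code_def prod.inject by (elim conjE)
    moreover have "(\<lambda>i. option_encode (fun_arity A i)) = (\<lambda>i. option_encode (fun_arity B i))"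
      using eq unfolding code_def prod.inject by (elim conjE)
    ultimately have 2: "rel_arity A = rel_arity B" "fun_arity A = fun_arity B"
      unfolding fun_eq_iff by (blast intro: opt)+
    have mem: "prod_encode (i, list_encode xs) \<in>
        {prod_encode (i, list_encode xs) | i xs. xs \<in> R i} \<longleftrightarrow> xs \<in> R i"
      for i xs and R :: "nat \<Rightarrow> nat list set"
      by (auto simp: prod_encode_eq list_encode_eq)
    have "xs \<in> rel_interp A i \<longleftrightarrow> xs \<in> rel_interp B i" for i xs
    proof -
      have "(\<lambda>n. of_bool (n \<in>
          {prod_encode (i, list_encode xs) | i xs. xs \<in> rel_interp A i}) :: nat) =
        (\<lambda>n. of_bool (n \<in>
          {prod_encode (i, list_encode xs) | i xs. xs \<in> rel_interp B i}))"
        using eq unfolding code_def prod.inject by (elim conjE)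
      from fun_cong[OF this, of "prod_encode (i, list_encode xs)"]
      have "prod_encode (i, list_encode xs) \<in>
          {prod_encode (i, list_encode xs) | i xs. xs \<in> rel_interp A i} \<longleftrightarrow>
        prod_encode (i, list_encode xs) \<in>
          {prod_encode (i, list_encode xs) | i xs. xs \<in> rel_interp B i}"
        by (rule of_bool_eq_iff[THEN iffD1])
      then show ?thesis unfolding mem .
    qed
    then have 3: "rel_interp A = rel_interp B" by auto
    have "fun_interp A i xs = fun_interp B i xs" for i xs
    proof (rule opt)
      have "(\<lambda>n. case prod_decode n of (i, c) \<Rightarrow> option_encode (fun_interp A i (list_decode c))) =
        (\<lambda>n. case prod_decode n of (i, c) \<Rightarrow> option_encode (fun_interp B i (list_decode c)))"
        using eq unfolding code_def prod.inject by (elim conjE)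
      from fun_cong[OF this, of "prod_encode (i, list_encode xs)"]
      show "option_encode (fun_interp A i xs) = option_encode (fun_interp B i xs)" by simp
    qed
    then have 4: "fun_interp A = fun_interp B" by (intro ext)
    show "A = B" using 1 2 3 4 by (intro struct.equality) simp_all
  qed
  moreover have "code ` Collect computable_struct \<subseteq>
      Collect computable \<times> Collect computable \<times> Collect computable \<times>
      Collect computable \<times> Collect computable"
    by (auto simp: code_def computable_struct_def computable_set_def)
  then have "countable (code ` Collect computable_struct)"
    by (rule countable_subset) (intro countable_SIGMA countable_computable)
  ultimately show ?thesis by (rule countable_image_inj_on[rotated])
qed

lemma isomorphic_refl: "wf_struct A \<Longrightarrow> isomorphic A A"
proof -
  assume wf: "wf_struct A"
  let ?f = "restrict id (universe A)"
  have map: "map ?f xs = xs" if "xs \<in> tuples (universe A) n" for xs n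
    using that by (auto simp: tuples_def intro!: map_idI)
  have opt: "map_option ?f (fun_interp A i xs) = fun_interp A i xs"
    if "fun_arity A i = Some n" for i n xs
  proof (cases "fun_interp A i xs")
    case (Some y)
    then have "y \<in> universe A"
      using wf that ranI[of "fun_interp A i" xs y] unfolding wf_struct_def
      by (metis (no_types, lifting) option.simps(5) subsetD)
    then show ?thesis using Some by simp
  qed simp
  have "struct_iso ?f A A"
    unfolding struct_iso_def by (auto simp: map opt bij_betw_def inj_on_def)
  then show ?thesis unfolding isomorphic_def by blast
qed

lemma ex_lists_copy_pairs:
  assumes "computable_struct M"
  shows "\<exists>P. lists_copy_pairs P M"
proof -
  have "computable_copies M \<noteq> {}"
    using assms isomorphic_refl by (auto simp: computable_copies_def computable_struct_def)
  moreover have "countable (computable_copies M)"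
    by (rule countable_subset[OF _ countable_computable_struct]) (auto simp: computable_copies_def)
  ultimately show ?thesis
    unfolding lists_copy_pairs_def
    by (intro exI[of _ "from_nat_into (computable_copies M \<times> computable_copies M)"]
        range_from_nat_into) auto
qed

end

theory Submission
  imports Defs
begin

text \<open>
  If \<open>CatSpec M\<close> is the intersection of \<open>IsoSpec (A j) (B j)\<close> over finitely many \<open>j\<close>, then the labelled
  disjoint unions of the \<open>A j\<close> and of the \<open>B j\<close> are copies of one computable structure with strong
  degree of categoricity \<open>d\<close>, because an isomorphism between them is a finite family of isomorphisms.
  Hence the spectral dimension of \<open>M\<close> is infinite. If every \<open>IsoSpec M B\<close> were finitely generated,
  no finite intersection of them could equal the cone above \<open>d\<close>, so Koenig's lemma would give a chain
  of degrees, none above \<open>d\<close>, that passes through a generator of each \<open>IsoSpec M B\<close>. A finite-extension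
  argument bounds this chain by a degree not above \<open>d\<close>, which contradicts \<open>CatSpec M = {d..}\<close>.
  Finally, a finite automorphism group would make every \<open>IsoSpec A B\<close> finitely generated.
\<close>


text \<open>The infinite join of a chain of sets can lie above \<open>d\<close> although no member
  does, since it depends on the sets chosen and can code arbitrary information. This obstacle shapes
  the finite-extension argument, which is one half of Spector's construction of an exact pair: each
  member of the chain is coded into a column only up to a finite error, and the freedom that this
  leaves serves to diagonalize. The labels of the disjoint unions make an isomorphism respect the
  components, which could otherwise be exchanged, all of them being copies of \<open>M\<close>.
  Functions are replaced by their graphs, because a function on one component is not total on the
  union. No computable map onto a copy of the union is available, but the pieces of the copy are
  computable all the same, as their relations can be read off from the labels. The number of
  components is finite because nothing makes the isomorphisms of infinitely many components
  uniformly computable in \<open>d\<close>.\<close>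

section \<open>A calculus of relative computability\<close>

text \<open>
  \<open>computes_from X vs f\<close>: one program with oracle \<open>X\<close> computes \<open>f a\<close> from the values of the
  functions \<open>vs\<close> at \<open>a\<close>, for all \<open>a\<close> of an arbitrary type. Binders extend \<open>a\<close> to a tuple and
  prepend to \<open>vs\<close>, as in \<open>cf_rec\<close> and \<open>cf_Least\<close> below.
\<close>

definition computes_from :: "nat set \<Rightarrow> ('a \<Rightarrow> nat) list \<Rightarrow> ('a \<Rightarrow> nat) \<Rightarrow> bool" where
  "computes_from X vs f \<longleftrightarrow> (\<exists>p. \<forall>a. eval X p (map (\<lambda>v. v a) vs) (f a))"

lemma computes_from_single: "computes_from X [\<lambda>n. n] f \<longleftrightarrow> computes X f"
  by (simp add: computes_from_def computes_def)

lemma cf_var: "f \<in> set vs \<Longrightarrow> computes_from X vs f"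
proof -
  assume "f \<in> set vs"
  then obtain i where i: "i < length vs" "vs ! i = f" by (auto simp: in_set_conv_nth)
  have "eval X (Proj i) (map (\<lambda>v. v a) vs) (f a)" for a
    using eval.Proj[of i "map (\<lambda>v. v a) vs" X] i by simp
  then show ?thesis unfolding computes_from_def by blast
qed

lemma cf_subst:
  assumes F: "computes_from X us F" and us: "\<And>u. u \<in> set us \<Longrightarrow> computes_from X vs (\<lambda>a. u (h a))"
  shows "computes_from X vs (\<lambda>a. F (h a))"
proof -
  obtain p where p: "\<And>b. eval X p (map (\<lambda>v. v b) us) (F b)"
    using F unfolding computes_from_def by blast
  have "\<forall>u\<in>set us. \<exists>q. \<forall>a. eval X q (map (\<lambda>v. v a) vs) (u (h a))"
    using us unfolding computes_from_def by blast
  then obtain q where q: "\<And>u a. u \<in> set us \<Longrightarrow> eval X (q u) (map (\<lambda>v. v a) vs) (u (h a))"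
    by metis
  have "eval X (Comp p (map q us)) (map (\<lambda>v. v a) vs) (F (h a))" for a
    by (rule eval.Comp[where ys = "map (\<lambda>v. v (h a)) us"]) (use q p in auto)
  then show ?thesis unfolding computes_from_def by blast
qed

lemma cf_unary:
  assumes "computes X g" "computes_from X vs f"
  shows "computes_from X vs (\<lambda>a. g (f a))"
  by (rule cf_subst[of X "[\<lambda>n. n]" g vs f]) (use assms in \<open>simp_all add: computes_from_single\<close>)

lemma cf_binary:
  assumes "computes_from X [fst, snd] (\<lambda>z. F (fst z) (snd z))"
    and "computes_from X vs f" "computes_from X vs g"
  shows "computes_from X vs (\<lambda>a. F (f a) (g a))"
  by (rule cf_subst[OF assms(1), of vs "\<lambda>a. (f a, g a)", simplified]) (use assms in auto)

lemma cf_Suc: "computes_from X vs f \<Longrightarrow> computes_from X vs (\<lambda>a. Suc (f a))"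
  by (rule cf_unary) (auto simp: computes_def intro: eval.Succ)

lemma cf_const: "computes_from X vs (\<lambda>a. c)"
proof (induction c)
  case 0
  show ?case unfolding computes_from_def by (blast intro: eval.Zero)
qed (rule cf_Suc)

lemma cf_rec:
  assumes A: "computes_from X vs A" and N: "computes_from X vs N"
    and B: "computes_from X ((\<lambda>z. snd (snd z)) # (\<lambda>z. fst (snd z)) # map (\<lambda>v z. v (fst z)) vs)
      (\<lambda>z. B (fst z) (fst (snd z)) (snd (snd z)))"
  shows "computes_from X vs (\<lambda>a. rec_nat (A a) (B a) (N a))"
proof -
  let ?F = "\<lambda>z. rec_nat (A (fst z)) (B (fst z)) (snd z)"
  obtain p where p: "\<And>a. eval X p (map (\<lambda>v. v a) vs) (A a)"
    using A unfolding computes_from_def by blast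
  obtain q where q: "\<And>a m r. eval X q (r # m # map (\<lambda>v. v a) vs) (B a m r)"
    using B unfolding computes_from_def by (auto simp: comp_def)
  have "eval X (PRec p q) (n # map (\<lambda>v. v a) vs) (rec_nat (A a) (B a) n)" for a n
    by (induction n) (use p q in \<open>auto intro: eval.intros\<close>)
  then have F: "computes_from X (snd # map (\<lambda>v z. v (fst z)) vs) ?F"
    unfolding computes_from_def by (auto simp: comp_def)
  show ?thesis
    by (rule cf_subst[OF F, of vs "\<lambda>a. (a, N a)", simplified]) (use N in \<open>auto intro: cf_var\<close>)
qed

section \<open>Arithmetic, decidable predicates and search\<close>

lemma cf_pred: "computes_from X vs f \<Longrightarrow> computes_from X vs (\<lambda>a. f a - 1)"
proof -
  assume f: "computes_from X vs f"
  have "computes_from X vs (\<lambda>a. rec_nat 0 (\<lambda>m r. m) (f a))"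
    by (intro cf_rec cf_const f) (simp add: cf_var)
  moreover have "rec_nat 0 (\<lambda>m r. m) n = n - 1" for n by (cases n) auto
  ultimately show ?thesis by simp
qed

lemma cf_plus:
  assumes f: "computes_from X vs f" and g: "computes_from X vs g"
  shows "computes_from X vs (\<lambda>a. f a + g a)"
proof -
  have "computes_from X vs (\<lambda>a. rec_nat (f a) (\<lambda>m r. Suc r) (g a))"
    by (intro cf_rec cf_Suc f g) (simp add: cf_var)
  moreover have "rec_nat k (\<lambda>m r. Suc r) n = k + n" for n k by (induction n) auto
  ultimately show ?thesis by simp
qed

lemma cf_minus:
  assumes f: "computes_from X vs f" and g: "computes_from X vs g"
  shows "computes_from X vs (\<lambda>a. f a - g a)"
proof -
  have "computes_from X vs (\<lambda>a. rec_nat (f a) (\<lambda>m r. r - 1) (g a))"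
    by (intro cf_rec cf_pred f g) (simp add: cf_var)
  moreover have "rec_nat k (\<lambda>m r. r - 1) n = k - n" for n k by (induction n) auto
  ultimately show ?thesis by simp
qed

lemma cf_mult:
  assumes f: "computes_from X vs f" and g: "computes_from X vs g"
  shows "computes_from X vs (\<lambda>a. f a * g a)"
proof -
  have "computes_from X vs (\<lambda>a. rec_nat 0 (\<lambda>m r. f a + r) (g a))"
  proof (intro cf_rec cf_plus cf_const g)
    show "computes_from X ((\<lambda>z. snd (snd z)) # (\<lambda>z. fst (snd z)) # map (\<lambda>v z. v (fst z)) vs)
      (\<lambda>z. f (fst z))"
      by (rule cf_subst[OF f]) (auto intro: cf_var)
  qed (simp add: cf_var)
  moreover have "rec_nat 0 (\<lambda>m r. k + r) n = k * n" for n k :: nat by (induction n) auto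
  ultimately show ?thesis by simp
qed

lemma cf_not:
  assumes "computes_from X vs (\<lambda>a. of_bool (P a))"
  shows "computes_from X vs (\<lambda>a. of_bool (\<not> P a))"
proof -
  have "computes_from X vs (\<lambda>a. 1 - of_bool (P a))"
    by (intro cf_minus cf_const assms)
  moreover have "1 - of_bool b = (of_bool (\<not> b) :: nat)" for b by simp
  ultimately show ?thesis by simp
qed

lemma cf_conj:
  assumes "computes_from X vs (\<lambda>a. of_bool (P a))" "computes_from X vs (\<lambda>a. of_bool (Q a))"
  shows "computes_from X vs (\<lambda>a. of_bool (P a \<and> Q a))"
  using cf_mult[OF assms] by (simp add: of_bool_conj)

lemma cf_disj:
  assumes "computes_from X vs (\<lambda>a. of_bool (P a))" "computes_from X vs (\<lambda>a. of_bool (Q a))"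
  shows "computes_from X vs (\<lambda>a. of_bool (P a \<or> Q a))"
  using cf_not[OF cf_conj[OF cf_not cf_not, OF assms]] by simp

lemma cf_less:
  assumes "computes_from X vs f" "computes_from X vs g"
  shows "computes_from X vs (\<lambda>a. of_bool (f a < g a))"
proof -
  have "computes_from X vs (\<lambda>a. 1 - (1 - (g a - f a)))"
    by (intro cf_minus cf_const assms)
  moreover have "1 - (1 - (n - m)) = (of_bool (m < n) :: nat)" for n m :: nat by auto
  ultimately show ?thesis by simp
qed

lemma cf_le:
  assumes "computes_from X vs f" "computes_from X vs g"
  shows "computes_from X vs (\<lambda>a. of_bool (f a \<le> g a))"
  using cf_not[OF cf_less, OF assms(2,1)] by (simp add: not_less)

lemma cf_eq:
  assumes "computes_from X vs f" "computes_from X vs g"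
  shows "computes_from X vs (\<lambda>a. of_bool (f a = g a))"
  using cf_conj[OF cf_le cf_le, OF assms assms(2,1)] by (simp add: eq_iff)

lemma cf_if:
  assumes P: "computes_from X vs (\<lambda>a. of_bool (P a))"
    and f: "computes_from X vs f" and g: "computes_from X vs g"
  shows "computes_from X vs (\<lambda>a. if P a then f a else g a)"
proof -
  have "computes_from X vs (\<lambda>a. of_bool (P a) * f a + of_bool (\<not> P a) * g a)"
    by (intro cf_plus cf_mult cf_not assms)
  moreover have "of_bool b * n + of_bool (\<not> b) * m = (if b then n else m)" for b and n m :: nat
    by simp
  ultimately show ?thesis by simp
qed

lemma cf_Least:
  assumes P: "computes_from X ((\<lambda>z. snd z) # map (\<lambda>v z. v (fst z)) vs)
      (\<lambda>z. of_bool (P (fst z) (snd z)))"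
    and ex: "\<And>a. \<exists>n. P a n"
  shows "computes_from X vs (\<lambda>a. LEAST n. P a n)"
proof -
  \<comment> \<open>\<open>Mu\<close> looks for a zero, so the program has to decide the negation of
    \<open>P\<close>.\<close>
  obtain p where p: "\<And>a n. eval X p (n # map (\<lambda>v. v a) vs) (of_bool (\<not> P a n))"
    using cf_not[OF P] unfolding computes_from_def by (auto simp: comp_def)
  have "eval X (Mu p) (map (\<lambda>v. v a) vs) (LEAST n. P a n)" for a
  proof (rule eval.Mu)
    show "eval X p ((LEAST n. P a n) # map (\<lambda>v. v a) vs) 0"
      using p[of "LEAST n. P a n" a] LeastI_ex[OF ex] by simp
    show "\<exists>k. eval X p (m # map (\<lambda>v. v a) vs) (Suc k)" if "m < (LEAST n. P a n)" for m
      using p[of m a] not_less_Least[OF that] by (intro exI[of _ 0]) simp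
  qed
  then show ?thesis unfolding computes_from_def by blast
qed

section \<open>The pairing function and its inverse\<close>

lemma cf_prod_encode:
  assumes "computes_from X vs f" "computes_from X vs g"
  shows "computes_from X vs (\<lambda>a. prod_encode (f a, g a))"
proof -
  have "computes_from X [\<lambda>n::nat. n] (rec_nat 0 (\<lambda>m r. r + Suc m))"
    by (rule cf_rec[of X "[\<lambda>n. n]" "\<lambda>_. 0" "\<lambda>n. n" "\<lambda>_ m r. r + Suc m"];
      (intro cf_const cf_plus cf_Suc)?; simp add: cf_var)
  moreover have "rec_nat 0 (\<lambda>m r. r + Suc m) = triangle"
  proof
    fix n show "rec_nat 0 (\<lambda>m r. r + Suc m) n = triangle n"
      by (induction n) auto
  qed
  ultimately have triangle: "computes X triangle" by (simp add: computes_from_single)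
  show ?thesis
    unfolding prod_encode_def prod.case by (intro cf_plus cf_unary[OF triangle] assms)
qed

text \<open>Decoding is a search over the encoder. The inner search must stop even if no
  \<open>b\<close> completes \<open>a\<close> to a code of \<open>n\<close>, and the disjunct
  \<open>b = n\<close> sees to that. It never preempts a genuine solution, because a component is at
  most the code of its pair.\<close>

lemma prod_decode_eq_Least:
  defines "T \<equiv> \<lambda>a n. LEAST b. b = n \<or> prod_encode (a, b) = n"
  shows "fst (prod_decode n) = (LEAST a. prod_encode (a, T a n) = n)"
    and "snd (prod_decode n) = T (fst (prod_decode n)) n"
proof -
  obtain a b where n: "n = prod_encode (a, b)" by (metis prod_decode_inverse surj_pair)
  have "T a n = b" unfolding T_def
  proof (rule Least_equality)
    show "b = n \<or> prod_encode (a, b) = n" using n by simp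
    show "b \<le> y" if "y = n \<or> prod_encode (a, y) = n" for y
      using that n le_prod_encode_2[of b a] by (auto simp: prod_encode_eq)
  qed
  moreover from this have "(LEAST a. prod_encode (a, T a n) = n) = a"
    by (intro Least_equality) (auto simp: n prod_encode_eq)
  ultimately show "fst (prod_decode n) = (LEAST a. prod_encode (a, T a n) = n)"
    "snd (prod_decode n) = T (fst (prod_decode n)) n"
    by (simp_all add: n)
qed

lemma cf_fst_decode_snd_decode:
  assumes f: "computes_from X vs f"
  shows cf_fst_decode: "computes_from X vs (\<lambda>a. fst (prod_decode (f a)))"
    and cf_snd_decode: "computes_from X vs (\<lambda>a. snd (prod_decode (f a)))"
proof -
  let ?T = "\<lambda>a n. LEAST b. b = n \<or> prod_encode (a, b) = n"
  have T: "computes_from X [fst, snd] (\<lambda>z. ?T (fst z) (snd z))"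
    by (intro cf_Least cf_disj cf_eq cf_prod_encode) (auto intro: cf_var)
  have 1: "computes X (\<lambda>n. fst (prod_decode n))"
    unfolding prod_decode_eq_Least(1) computes_from_single[symmetric]
  proof (rule cf_Least, intro cf_eq cf_prod_encode cf_binary[OF T])
    show "\<exists>m. prod_encode (m, ?T m n) = n" for n
    proof -
      have "prod_encode (fst (prod_decode n), snd (prod_decode n)) = n" by simp
      then show ?thesis unfolding prod_decode_eq_Least(2)[of n] by blast
    qed
  qed (auto intro: cf_var)
  show "computes_from X vs (\<lambda>a. fst (prod_decode (f a)))"
    by (rule cf_unary[OF 1 f])
  show "computes_from X vs (\<lambda>a. snd (prod_decode (f a)))"
    unfolding prod_decode_eq_Least(2)[of "f _"] by (intro cf_binary[OF T] cf_unary[OF 1] f)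
qed

lemmas cf_intros = cf_Suc cf_const cf_plus cf_minus cf_mult cf_not cf_conj cf_disj cf_less cf_le
  cf_eq cf_if cf_prod_encode cf_fst_decode cf_snd_decode

text \<open>Takes care of the empty list below: its code is 0, and \<open>0 - 1 = 0\<close> decodes
  to \<open>(0, 0)\<close>, so that 0 results as the head and the code of \<open>[]\<close> as the
  tail.\<close>

lemma prod_decode_0 [simp]: "prod_decode 0 = (0, 0)"
  using prod_encode_inverse[of "(0, 0)"] by (simp add: prod_encode_def del: prod_encode_inverse)

section \<open>Operations on coded lists\<close>

lemma cf_Cons:
  assumes "computes_from X vs f" "computes_from X vs (\<lambda>a. list_encode (g a))"
  shows "computes_from X vs (\<lambda>a. list_encode (f a # g a))"
  by (auto intro!: cf_intros assms)

lemma cf_Nil_test: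
  assumes "computes_from X vs (\<lambda>a. list_encode (g a))"
  shows "computes_from X vs (\<lambda>a. of_bool (g a = []))"
proof -
  have "g a = [] \<longleftrightarrow> list_encode (g a) = 0" for a by (cases "g a") auto
  then show ?thesis by (auto intro!: cf_intros assms)
qed

lemma cf_tl:
  assumes "computes_from X vs (\<lambda>a. list_encode (g a))"
  shows "computes_from X vs (\<lambda>a. list_encode (tl (g a)))"
proof -
  have "list_encode (tl (g a)) = snd (prod_decode (list_encode (g a) - 1))" for a
    by (cases "g a") auto
  then show ?thesis by (simp only: cf_snd_decode cf_pred assms)
qed

lemma cf_hd:
  assumes "computes_from X vs (\<lambda>a. list_encode (g a))"
  shows "computes_from X vs (\<lambda>a. if g a = [] then 0 else hd (g a))"
proof -
  have "(if g a = [] then 0 else hd (g a)) = fst (prod_decode (list_encode (g a) - 1))" for a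
    by (cases "g a") auto
  then show ?thesis by (simp only: cf_fst_decode cf_pred assms)
qed

lemma length_le_list_encode: "length xs \<le> list_encode xs"
proof (induction xs)
  case (Cons x xs)
  then show ?case using le_prod_encode_2[of "list_encode xs" x] by simp
qed simp

text \<open>The fold is run for as many steps as the code of the list, which bounds its length.\<close>

lemma cf_fold:
  assumes B: "computes_from X ((\<lambda>z. snd (snd z)) # (\<lambda>z. fst (snd z)) # map (\<lambda>v z. v (fst z)) vs)
      (\<lambda>z. B (fst z) (fst (snd z)) (snd (snd z)))"
    and L: "computes_from X vs (\<lambda>a. list_encode (L a))" and A: "computes_from X vs A"
  shows "computes_from X vs (\<lambda>a. fold (B a) (L a) (A a))"
proof -
  \<comment> \<open>A state pairs the code of the remaining list with the accumulator. Code 0 is the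
    empty list; such states are fixed, so surplus steps do no harm.\<close>
  define step where "step = (\<lambda>a s. if fst (prod_decode s) = 0 then s else
    prod_encode (snd (prod_decode (fst (prod_decode s) - 1)),
      B a (fst (prod_decode (fst (prod_decode s) - 1))) (snd (prod_decode s))))"
  let ?run = "\<lambda>a xs c n. rec_nat (prod_encode (list_encode xs, c)) (\<lambda>_. step a) n"
  have run: "snd (prod_decode (?run a xs c n)) = fold (B a) xs c" if "length xs \<le> n" for a xs c n
    using that
  proof (induction xs arbitrary: c n)
    case Nil
    have "?run a [] c n = prod_encode (0, c)" by (induction n) (auto simp: step_def)
    then show ?case by simp
  next
    case (Cons x xs)
    then obtain m where n: "n = Suc m" and m: "length xs \<le> m" by (cases n) auto
    \<comment> \<open>The recursion adds its new step at the end, whereas the fold consumes its list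
      at the front. The two agree because \<open>step\<close> ignores the counter.\<close>
    have "?run a (x # xs) c (Suc k) = ?run a xs (B a x c) k" for k
      by (induction k) (auto simp: step_def)
    then have "?run a (x # xs) c n = ?run a xs (B a x c) m" unfolding n .
    then show ?case using Cons.IH[OF m] by simp
  qed
  let ?us = "(\<lambda>z. snd (snd z)) # (\<lambda>z. fst (snd z)) # map (\<lambda>v z. v (fst z)) vs"
  have B': "computes_from X ?us (\<lambda>z. B (fst z) (f z) (g z))"
    if "computes_from X ?us f" "computes_from X ?us g" for f g
    by (rule cf_subst[OF B, of ?us "\<lambda>z. (fst z, f z, g z)", simplified])
      (use that in \<open>auto intro: cf_var\<close>)
  have "computes_from X vs (\<lambda>a. ?run a (L a) (A a) (list_encode (L a)))"
    unfolding step_def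
    by (intro cf_rec cf_intros B' L A) (auto intro: cf_var)
  then have "computes_from X vs (\<lambda>a. snd (prod_decode (?run a (L a) (A a) (list_encode (L a)))))"
    by (rule cf_snd_decode)
  then show ?thesis by (simp add: run length_le_list_encode)
qed

lemma cf_rev:
  assumes L: "computes_from X vs (\<lambda>a. list_encode (L a))"
  shows "computes_from X vs (\<lambda>a. list_encode (rev (L a)))"
proof -
  have "fold (\<lambda>x c. Suc (prod_encode (x, c))) xs (list_encode ys) = list_encode (rev xs @ ys)"
    for xs ys
    by (induction xs arbitrary: ys) (auto simp flip: list_encode.simps(2))
  from this[of _ "[]"] have *: "list_encode (rev xs) = fold (\<lambda>x c. Suc (prod_encode (x, c))) xs 0" for xs
    by simp
  show ?thesis unfolding *
    by (intro cf_fold cf_intros L) (auto intro: cf_var)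
qed

text \<open>Consing in a fold reverses the order, so the fold is run on the reversed list.\<close>

lemma cf_map:
  assumes L: "computes_from X vs (\<lambda>a. list_encode (L a))"
    and g: "computes_from X (snd # map (\<lambda>v z. v (fst z)) vs) (\<lambda>z. g (fst z) (snd z))"
  shows "computes_from X vs (\<lambda>a. list_encode (map (g a) (L a)))"
proof -
  have "fold (\<lambda>x c. Suc (prod_encode (g a x, c))) xs (list_encode ys) =
      list_encode (map (g a) (rev xs) @ ys)" for a xs ys
    by (induction xs arbitrary: ys) (auto simp flip: list_encode.simps(2))
  from this[of _ _ "[]"] have *: "list_encode (map (g a) xs) =
      fold (\<lambda>x c. Suc (prod_encode (g a x, c))) (rev xs) 0" for a xs
    by simp
  let ?us = "(\<lambda>z. snd (snd z)) # (\<lambda>z. fst (snd z)) # map (\<lambda>v z. v (fst z)) vs"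
  have "computes_from X ?us (\<lambda>z. g (fst z) (fst (snd z)))"
    by (rule cf_subst[OF g, of ?us "\<lambda>z. (fst z, fst (snd z))", simplified]) (auto intro: cf_var)
  then show ?thesis unfolding *
    by (intro cf_fold cf_intros cf_rev L) (auto intro: cf_var)
qed

lemma cf_length:
  assumes L: "computes_from X vs (\<lambda>a. list_encode (L a))"
  shows "computes_from X vs (\<lambda>a. length (L a))"
proof -
  have "fold (\<lambda>x c. Suc c) xs k = length xs + k" for xs :: "nat list" and k
    by (induction xs arbitrary: k) auto
  from this[of _ 0] have *: "length xs = fold (\<lambda>x c. Suc c) xs 0" for xs :: "nat list" by simp
  show ?thesis unfolding *
    by (intro cf_fold cf_intros L) (auto intro: cf_var)
qed

lemma cf_list_all:
  assumes L: "computes_from X vs (\<lambda>a. list_encode (L a))"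
    and P: "computes_from X (snd # map (\<lambda>v z. v (fst z)) vs) (\<lambda>z. of_bool (P (fst z) (snd z)))"
  shows "computes_from X vs (\<lambda>a. of_bool (list_all (P a) (L a)))"
proof -
  have "fold (\<lambda>x c. c * of_bool (P a x)) xs k = k * of_bool (list_all (P a) xs)" for a xs and k :: nat
    by (induction xs arbitrary: k) auto
  from this[of _ _ 1] have *: "of_bool (list_all (P a) xs) =
      fold (\<lambda>x c. c * of_bool (P a x)) xs (1::nat)" for a xs
    by simp
  let ?us = "(\<lambda>z. snd (snd z)) # (\<lambda>z. fst (snd z)) # map (\<lambda>v z. v (fst z)) vs"
  have "computes_from X ?us (\<lambda>z. of_bool (P (fst z) (fst (snd z))))"
    by (rule cf_subst[OF P, of ?us "\<lambda>z. (fst z, fst (snd z))", simplified]) (auto intro: cf_var)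
  then show ?thesis unfolding *
    by (intro cf_fold cf_intros L) (auto intro: cf_var)
qed

lemma cf_in_set:
  assumes "computes_from X vs f" and L: "computes_from X vs (\<lambda>a. list_encode (L a))"
  shows "computes_from X vs (\<lambda>a. of_bool (f a \<in> set (L a)))"
proof -
  have *: "f a \<in> set (L a) \<longleftrightarrow> \<not> list_all (\<lambda>y. \<not> f a = y) (L a)" for a
    by (auto simp: list_all_iff)
  show ?thesis unfolding *
    by (intro cf_list_all cf_intros L cf_subst[OF assms(1)]) (auto intro: cf_var)
qed

section \<open>Oracles and finite sets\<close>

lemma cf_oracle: "computes_from X vs f \<Longrightarrow> computes_from X vs (\<lambda>a. of_bool (f a \<in> X))"
  by (rule cf_unary) (use turing_le_refl in \<open>auto simp: turing_le_def\<close>)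

lemma turing_le_empty: "turing_le {} X"
  using cf_const[of X "[\<lambda>n. n]" 0] by (simp add: turing_le_def computes_from_single)

lemma computes_if_computable: "computable f \<Longrightarrow> computes X f"
  unfolding computable_def using computes_mono turing_le_empty by blast

lemma cf_finite:
  assumes "finite F" "computes_from X vs f"
  shows "computes_from X vs (\<lambda>a. of_bool (f a \<in> F))"
  using assms(1)
proof (induction F rule: finite_induct)
  case (insert x F)
  then show ?case unfolding insert_iff by (intro cf_intros assms(2))
qed (simp add: cf_const)


section \<open>Evaluation with bounded search\<close>

text \<open>
  An evaluator for programs in which only unbounded search consumes fuel. This makes it total and
  computable uniformly in the fuel, in the oracle and in the arguments.
\<close>

fun bounded_eval :: "nat set \<Rightarrow> nat \<Rightarrow> recf \<Rightarrow> nat list \<Rightarrow> nat option" where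
  "bounded_eval X s Zero xs = Some 0"
| "bounded_eval X s Succ xs = (if xs = [] then None else Some (Suc (hd xs)))"
| "bounded_eval X s (Proj i) xs = (if i < length xs then Some (xs ! i) else None)"
| "bounded_eval X s Query xs = (if xs = [] then None else Some (of_bool (hd xs \<in> X)))"
| "bounded_eval X s (Comp p gs) xs =
    Option.bind (those (map (\<lambda>g. bounded_eval X s g xs) gs)) (\<lambda>ys. bounded_eval X s p ys)"
| "bounded_eval X s (PRec p q) xs = (if xs = [] then None else
    rec_nat (bounded_eval X s p (tl xs))
      (\<lambda>m r. Option.bind r (\<lambda>r. bounded_eval X s q (r # m # tl xs))) (hd xs))"
| "bounded_eval X s (Mu p) xs =
    (if (\<exists>n<s. bounded_eval X s p (n # xs) = Some 0 \<and> (\<forall>m<n. \<exists>k. bounded_eval X s p (m # xs) = Some (Suc k)))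
     then Some (LEAST n. bounded_eval X s p (n # xs) = Some 0) else None)"

lemma those_eq_Some_iff: "those os = Some ys \<longleftrightarrow> os = map Some ys"
proof (induction os arbitrary: ys)
  case (Cons a os)
  show ?case by (cases a; cases ys) (auto simp: Cons.IH)
qed auto

lemma Least_eq_first: "P n \<Longrightarrow> (\<And>m. m < n \<Longrightarrow> \<not> P m) \<Longrightarrow> (LEAST n. P n) = n" for n :: nat
  by (rule Least_equality) (auto simp: not_less[symmetric])

lemma if_Some_None: "(if P then Some a else None) = Some y \<longleftrightarrow> P \<and> y = a"
  by auto

lemma eval_if_bounded_eval: "bounded_eval X s p xs = Some y \<Longrightarrow> eval X p xs y"
proof (induction p arbitrary: xs y)
  case Zero
  then show ?case by (auto intro: eval.intros)
next
  case Succ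
  then show ?case by (cases xs) (auto intro: eval.intros)
next
  case (Proj i)
  then show ?case by (auto intro: eval.intros split: if_splits)
next
  case Query
  then show ?case using eval.Query[of X "hd xs" "tl xs"] by (cases xs) auto
next
  case (Comp p gs)
  from Comp.prems obtain ys where ys: "map (\<lambda>g. bounded_eval X s g xs) gs = map Some ys"
    and y: "bounded_eval X s p ys = Some y"
    by (auto simp: bind_eq_Some_conv those_eq_Some_iff)
  have len: "length ys = length gs" using ys by (metis length_map)
  have "bounded_eval X s (gs ! i) xs = Some (ys ! i)" if "i < length gs" for i
    using that ys len by (metis nth_map)
  then show ?case
    using len Comp.IH(1)[OF y] Comp.IH(2)[OF nth_mem] by (blast intro: eval.Comp)
next
  case (PRec p q)
  then obtain n zs where xs: "xs = n # zs" by (cases xs) auto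
  have "rec_nat (bounded_eval X s p zs)
      (\<lambda>m r. Option.bind r (\<lambda>r. bounded_eval X s q (r # m # zs))) n = Some y \<Longrightarrow>
      eval X (PRec p q) (n # zs) y" for y
  proof (induction n arbitrary: y)
    case 0
    then show ?case using PRec.IH(1) by (auto intro: eval.intros)
  next
    case (Suc n)
    then show ?case using PRec.IH(2) by (auto intro: eval.intros simp: bind_eq_Some_conv)
  qed
  with PRec.prems show ?case by (simp add: xs)
next
  case (Mu p)
  let ?E = "\<lambda>n. bounded_eval X s p (n # xs)"
  from Mu.prems have *: "(\<exists>n<s. ?E n = Some 0 \<and> (\<forall>m<n. \<exists>k. ?E m = Some (Suc k))) \<and>
      y = (LEAST n. ?E n = Some 0)"
    unfolding bounded_eval.simps if_Some_None .
  then obtain n where n: "?E n = Some 0" and m: "\<And>m. m < n \<Longrightarrow> \<exists>k. ?E m = Some (Suc k)"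
    and y: "y = (LEAST n. ?E n = Some 0)"
    by auto
  have "?E k \<noteq> Some 0" if "k < n" for k using m[OF that] by auto
  then have "y = n" unfolding y by (intro Least_eq_first n)
  show ?case unfolding \<open>y = n\<close>
  proof (rule eval.Mu)
    show "eval X p (n # xs) 0" by (rule Mu.IH[OF n])
    show "\<exists>k. eval X p (m # xs) (Suc k)" if "m < n" for m using m[OF that] Mu.IH by blast
  qed
qed

text \<open>Serves the rules of \<open>eval\<close> with a varying finite number of premises,
  \<open>Comp\<close> and \<open>Mu\<close>, here and again in the use principle.\<close>

lemma ex_bound_common:
  fixes n :: nat
  assumes "\<And>i. i < n \<Longrightarrow> \<exists>b::nat. \<forall>s\<ge>b. P i s"
  shows "\<exists>b. \<forall>i<n. \<forall>s\<ge>b. P i s"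
proof -
  obtain b where b: "\<And>i s. i < n \<Longrightarrow> b i \<le> s \<Longrightarrow> P i s" using assms by metis
  have "P i s" if "i < n" "Max (b ` {..<n}) \<le> s" for i s
  proof (rule b[OF that(1)])
    have "b i \<le> Max (b ` {..<n})" using that(1) by (intro Max_ge) auto
    with that(2) show "b i \<le> s" by linarith
  qed
  then show ?thesis by blast
qed

text \<open>Subprograms run with the same fuel as the whole program, so several premises must be met
  at a common fuel. An induction for all sufficiently large fuels allows taking the maximum of their
  thresholds.\<close>

lemma bounded_eval_if_eval:
  "eval X p xs y \<Longrightarrow> \<exists>s0. \<forall>s\<ge>s0. bounded_eval X s p xs = Some y"
proof (induction rule: eval.induct)
  case (Comp ys gs xs p z)
  obtain s1 where s1: "\<And>i s. i < length gs \<Longrightarrow> s1 \<le> s \<Longrightarrow>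
      bounded_eval X s (gs ! i) xs = Some (ys ! i)"
    using ex_bound_common[of "length gs" "\<lambda>i s. bounded_eval X s (gs ! i) xs = Some (ys ! i)"]
      Comp.IH(1) by blast
  obtain s2 where s2: "\<And>s. s2 \<le> s \<Longrightarrow> bounded_eval X s p ys = Some z"
    using Comp.IH(2) by blast
  have "map (\<lambda>g. bounded_eval X s g xs) gs = map Some ys" if "s1 \<le> s" for s
    by (intro nth_equalityI) (use s1[OF _ that] Comp.hyps in auto)
  then have "those (map (\<lambda>g. bounded_eval X s g xs) gs) = Some ys" if "s1 \<le> s" for s
    using that by (simp add: those_eq_Some_iff)
  then have "bounded_eval X s (Comp p gs) xs = Some z" if "max s1 s2 \<le> s" for s
    using s2 that by simp
  then show ?case by blast
next
  case (PRec_Suc p q n xs r y)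
  then obtain s1 s2 where "\<And>s. s1 \<le> s \<Longrightarrow> bounded_eval X s (PRec p q) (n # xs) = Some r"
    "\<And>s. s2 \<le> s \<Longrightarrow> bounded_eval X s q (r # n # xs) = Some y" by blast
  then have "bounded_eval X s (PRec p q) (Suc n # xs) = Some y" if "max s1 s2 \<le> s" for s
    using that by simp
  then show ?case by blast
next
  case (Mu p n xs)
  obtain s1 where s1: "\<And>s. s1 \<le> s \<Longrightarrow> bounded_eval X s p (n # xs) = Some 0"
    using Mu.IH(1) by blast
  have "\<exists>b. \<forall>s\<ge>b. \<exists>k. bounded_eval X s p (m # xs) = Some (Suc k)" if "m < n" for m
    using Mu.IH(2)[OF that] by blast
  from ex_bound_common[of n "\<lambda>m s. \<exists>k. bounded_eval X s p (m # xs) = Some (Suc k)", OF this]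
  obtain s2 where s2: "\<And>m s. m < n \<Longrightarrow> s2 \<le> s \<Longrightarrow>
      \<exists>k. bounded_eval X s p (m # xs) = Some (Suc k)" by blast
  \<comment> \<open>\<open>Suc n\<close> is there because the bounded search inspects only
    candidates strictly below the fuel.\<close>
  have "bounded_eval X s (Mu p) xs = Some n" if "max (Suc n) (max s1 s2) \<le> s" for s
  proof -
    have "(LEAST n. bounded_eval X s p (n # xs) = Some 0) = n"
      by (rule Least_eq_first) (use s1 s2 that in fastforce)+
    moreover have "\<exists>n<s. bounded_eval X s p (n # xs) = Some 0 \<and>
        (\<forall>m<n. \<exists>k. bounded_eval X s p (m # xs) = Some (Suc k))"
      using s1 s2 that by (intro exI[of _ n]) auto
    ultimately show ?thesis by simp
  qed
  then show ?case by blast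
qed auto

lemma eval_iff_bounded_eval: "eval X p xs y \<longleftrightarrow> (\<exists>s. bounded_eval X s p xs = Some y)"
  using eval_if_bounded_eval bounded_eval_if_eval by blast

section \<open>Computability of the bounded evaluator\<close>

lemma cf_bind:
  assumes f: "computes_from X vs (\<lambda>a. option_encode (f a))"
    and g: "computes_from X (snd # map (\<lambda>v z. v (fst z)) vs)
      (\<lambda>z. option_encode (g (fst z) (snd z)))"
  shows "computes_from X vs (\<lambda>a. option_encode (Option.bind (f a) (g a)))"
proof -
  have *: "option_encode (Option.bind (f a) (g a)) = (if option_encode (f a) = 0 then 0
      else option_encode (g a (option_encode (f a) - 1)))" for a
    by (cases "f a") auto
  have "computes_from X vs (\<lambda>a. option_encode (g a (option_encode (f a) - 1)))"
    by (rule cf_subst[OF g, of vs "\<lambda>a. (a, option_encode (f a) - 1)", unfolded fst_conv snd_conv])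
      (use cf_pred[OF f] in \<open>auto intro: cf_var\<close>)
  then show ?thesis unfolding * by (intro cf_intros f)
qed

text \<open>The search for a witness is cut off at \<open>N a\<close>, which makes it total. A
  witness exists iff the search stops earlier.\<close>

lemma cf_bex_less:
  assumes P: "computes_from X (snd # map (\<lambda>v z. v (fst z)) vs)
      (\<lambda>z. of_bool (P (fst z) (snd z)))"
    and N: "computes_from X vs N"
  shows "computes_from X vs (\<lambda>a. of_bool (\<exists>n<N a. P a n))"
proof -
  let ?L = "\<lambda>a. LEAST n. N a \<le> n \<or> P a n"
  have "(\<exists>n<N a. P a n) \<longleftrightarrow> ?L a < N a" for a
    using LeastI[of "\<lambda>n. N a \<le> n \<or> P a n" "N a"] Least_le[of "\<lambda>n. N a \<le> n \<or> P a n"]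
    by (meson le_less_trans not_le order_refl)
  moreover have "computes_from X vs ?L"
    by (rule cf_Least, intro cf_disj cf_le cf_subst[OF N] P) (auto intro: cf_var)
  ultimately show ?thesis by (simp add: cf_less N)
qed

lemma cf_nth:
  assumes "computes_from X vs (\<lambda>a. list_encode (g a))"
  shows "computes_from X vs (\<lambda>a. option_encode (if i < length (g a) then Some (g a ! i) else None))"
proof -
  have drop: "computes_from X vs (\<lambda>a. list_encode (drop i (g a)))"
    by (induction i) (use assms cf_tl in \<open>auto simp: drop_Suc simp flip: tl_drop\<close>)
  have *: "option_encode (if i < length xs then Some (xs ! i) else None) =
      (if length xs \<le> i then 0 else Suc (if drop i xs = [] then 0 else hd (drop i xs)))" for xs
    by (auto simp: hd_drop_conv_nth)
  show ?thesis unfolding * by (intro cf_intros cf_length cf_hd drop assms)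
qed

text \<open>The program \<open>p\<close> stays fixed, so neither a coding of programs nor a
  universal machine is needed: the induction builds one evaluator for each \<open>p\<close>. The
  oracle ranges over a family that is uniformly computable in \<open>X\<close>, because the
  construction below tries one program on infinitely many oracles.\<close>

lemma cf_bounded_eval:
  fixes Z :: "nat \<Rightarrow> nat set"
  assumes Z: "computes_from X [fst, snd] (\<lambda>z. of_bool (snd z \<in> Z (fst z)))"
  shows "computes_from X [fst, \<lambda>z. fst (snd z), \<lambda>z. list_encode (snd (snd z))]
    (\<lambda>z. option_encode (bounded_eval (Z (fst (snd z))) (fst z) p (snd (snd z))))"
proof (induction p)
  let ?vs = "[fst, \<lambda>z. fst (snd z), \<lambda>z. list_encode (snd (snd z))]"
  let ?B = "\<lambda>p s t xs. option_encode (bounded_eval (Z t) s p xs)"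
  have sub: "computes_from X vs (\<lambda>a. ?B p (f a) (g a) (h a))"
    if "computes_from X ?vs (\<lambda>z. ?B p (fst z) (fst (snd z)) (snd (snd z)))"
      "computes_from X vs f" "computes_from X vs g" "computes_from X vs (\<lambda>a. list_encode (h a))"
    for p f g h and vs :: "('x \<Rightarrow> nat) list"
    by (rule cf_subst[OF that(1), of vs "\<lambda>a. (f a, g a, h a)", unfolded fst_conv snd_conv])
      (use that(2-) in auto)
  have xs: "computes_from X ?vs (\<lambda>z. list_encode (snd (snd z)))"
    by (simp add: cf_var)
  note hd = cf_hd[OF xs] and nil = cf_Nil_test[OF xs] and tl = cf_tl[OF xs]
  {
    case Zero
    show ?case by (simp add: cf_const)
  next
    case Succ
    have "?B Succ s t xs = (if xs = [] then 0 else Suc (Suc (if xs = [] then 0 else hd xs)))" for s t xs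
      by simp
    then show ?case by (simp only:) (intro cf_intros hd nil)
  next
    case (Proj i)
    show ?case using cf_nth[OF xs, of i] by simp
  next
    case Query
    have *: "?B Query s t xs = (if xs = [] then 0 else Suc (of_bool ((if xs = [] then 0 else hd xs) \<in> Z t)))"
      for s t xs by simp
    show ?case unfolding *
      by (intro cf_intros nil cf_binary[OF Z] hd) (simp add: cf_var)
  next
    case (Comp p gs)
    \<comment> \<open>The intermediate results must be passed on as one number, so the option
      carries the code of their list, which the second half decodes again.\<close>
    have "computes_from X ?vs (\<lambda>z. option_encode (map_option list_encode
        (those (map (\<lambda>g. bounded_eval (Z (fst (snd z))) (fst z) g (snd (snd z))) gs))))"
      using Comp.IH(2)
    proof (induction gs)
      case Nil
      show ?case by (simp add: cf_const)
    next
      case (Cons g gs)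
      let ?o = "\<lambda>z. bounded_eval (Z (fst (snd z))) (fst z) g (snd (snd z))"
      let ?os = "\<lambda>z. those (map (\<lambda>g. bounded_eval (Z (fst (snd z))) (fst z) g (snd (snd z))) gs)"
      have IH: "computes_from X ?vs (\<lambda>z. option_encode (map_option list_encode (?os z)))"
        using Cons by auto
      have g: "computes_from X ?vs (\<lambda>z. option_encode (?o z))"
        using Cons.prems by simp
      have "option_encode (map_option list_encode (case o1 of None \<Rightarrow> None | Some y \<Rightarrow> map_option ((#) y) o2)) =
        (if option_encode o1 = 0 then 0 else if option_encode (map_option list_encode o2) = 0 then 0
         else Suc (Suc (prod_encode (option_encode o1 - 1, option_encode (map_option list_encode o2) - 1))))"
        for o1 o2 by (cases o1; cases o2) auto
      then show ?case by (simp only: those.simps list.map) (intro cf_intros IH g)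
    qed
    moreover have "bounded_eval (Z t) s (Comp p gs) xs = Option.bind (map_option list_encode
        (those (map (\<lambda>g. bounded_eval (Z t) s g xs) gs)))
        (\<lambda>c. bounded_eval (Z t) s p (list_decode c))" for t s xs
      by (simp add: map_option_case split: option.split)
    ultimately show ?case
      by (simp only:) (intro cf_bind sub[OF Comp.IH(1)]; simp add: cf_var)
  next
    case (PRec p q)
    let ?F = "\<lambda>z. rec_nat (?B p (fst z) (fst (snd z)) (tl (snd (snd z))))
      (\<lambda>m r. if r = 0 then 0 else ?B q (fst z) (fst (snd z)) ((r - 1) # m # tl (snd (snd z))))
      (if snd (snd z) = [] then 0 else hd (snd (snd z)))"
    \<comment> \<open>The recursion moves from options to their codes: 0 stands for failure and
      \<open>r - 1\<close> is the value.\<close>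
    have "option_encode (rec_nat b (\<lambda>m r. Option.bind r (\<lambda>r. f r m)) n) =
        rec_nat (option_encode b) (\<lambda>m r. if r = 0 then 0 else option_encode (f (r - 1) m)) n" for b f n
    proof (induction n)
      case (Suc n)
      show ?case unfolding old.nat.rec(2) Suc.IH[symmetric]
        by (cases "rec_nat b (\<lambda>m r. Option.bind r (\<lambda>r. f r m)) n") auto
    qed simp
    then have *: "?B (PRec p q) (fst z) (fst (snd z)) (snd (snd z)) = (if snd (snd z) = [] then 0 else ?F z)" for z
      by simp
    let ?us = "(\<lambda>z. snd (snd z)) # (\<lambda>z. fst (snd z)) # map (\<lambda>v z. v (fst z)) ?vs"
    have tl': "computes_from X ?us (\<lambda>z. list_encode (tl (snd (snd (fst z)))))"
      by (rule cf_tl) (simp add: cf_var)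
    have "computes_from X ?vs ?F"
      by (intro cf_rec hd cf_if cf_eq cf_const sub[OF PRec.IH(1)] sub[OF PRec.IH(2)] cf_Cons tl tl' cf_pred)
        (simp_all add: cf_var)
    then show ?case unfolding * by (intro cf_intros nil)
  next
    case (Mu p)
    let ?E = "\<lambda>z n. ?B p (fst z) (fst (snd z)) (n # snd (snd z))"
    \<comment> \<open>In codes, \<open>= 1\<close> says that the result is 0, and \<open>1 <\<close>
      that it is a positive number. The minimization is stopped at the fuel to keep it
      total.\<close>
    have *: "?B (Mu p) (fst z) (fst (snd z)) (snd (snd z)) =
      (if \<exists>n<fst z. ?E z n = 1 \<and> \<not> (\<exists>m<n. \<not> 1 < ?E z m)
       then Suc (LEAST n. fst z \<le> n \<or> ?E z n = 1) else 0)" for z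
    proof -
      let ?b = "\<lambda>n. bounded_eval (Z (fst (snd z))) (fst z) p (n # snd (snd z))"
      have 1: "?E z n = 1 \<longleftrightarrow> ?b n = Some 0" for n by (cases "?b n") auto
      have 2: "1 < ?E z n \<longleftrightarrow> (\<exists>k. ?b n = Some (Suc k))" for n
        by (cases "?b n") (auto simp: gr0_conv_Suc)
      have 3: "(LEAST n. fst z \<le> n \<or> ?b n = Some 0) = (LEAST n. ?b n = Some 0)"
        if "\<exists>n<fst z. ?b n = Some 0"
      proof (rule Least_eq_first)
        show "fst z \<le> (LEAST n. ?b n = Some 0) \<or> ?b (LEAST n. ?b n = Some 0) = Some 0"
          using LeastI_ex[of "\<lambda>n. ?b n = Some 0"] that by blast
        fix m assume m: "m < (LEAST n. ?b n = Some 0)"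
        have "(LEAST n. ?b n = Some 0) < fst z"
          using that Least_le[of "\<lambda>n. ?b n = Some 0"] le_less_trans by blast
        then have "\<not> fst z \<le> m" using m by linarith
        then show "\<not> (fst z \<le> m \<or> ?b m = Some 0)"
          using not_less_Least[OF m] by blast
      qed
      show ?thesis
      proof (cases "\<exists>n<fst z. ?b n = Some 0")
        case True
        show ?thesis unfolding 1 2 bounded_eval.simps 3[OF True] by auto
      next
        case False
        then show ?thesis unfolding 1 2 bounded_eval.simps by auto
      qed
    qed
    have n: "computes_from X (snd # map (\<lambda>v z. v (fst z)) ?vs) (\<lambda>z. ?E (fst z) (snd z))"
      by (intro sub[OF Mu.IH] cf_Cons) (simp_all add: cf_var)
    have m: "computes_from X (snd # map (\<lambda>v z. v (fst z)) (snd # map (\<lambda>v z. v (fst z)) ?vs))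
      (\<lambda>z. ?E (fst (fst z)) (snd z))"
      by (intro sub[OF Mu.IH] cf_Cons) (simp_all add: cf_var)
    show ?case unfolding *
      by (intro cf_if cf_bex_less cf_conj cf_not cf_eq cf_less cf_le cf_disj cf_const n m cf_Suc cf_Least)
        (auto intro: cf_var)
  }
qed


section \<open>Upper bounds of chains avoiding a cone\<close>

text \<open>Relative to a set rather than an initial segment, because a stage of the construction
  fixes whole columns as well.\<close>

definition agree_on :: "nat set \<Rightarrow> nat set \<Rightarrow> nat set \<Rightarrow> bool" where
  "agree_on S X Y \<longleftrightarrow> (\<forall>x\<in>S. x \<in> X \<longleftrightarrow> x \<in> Y)"

lemma agree_on_mono: "agree_on S X Y \<Longrightarrow> T \<subseteq> S \<Longrightarrow> agree_on T X Y"
  by (auto simp: agree_on_def)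

text \<open>A halting computation asks only finitely many questions: every rule of
  \<open>eval\<close>, including \<open>Mu\<close>, has finitely many premises, so their bounds have
  a maximum.\<close>

lemma use_principle:
  "eval X p xs y \<Longrightarrow> \<exists>l. \<forall>Y. agree_on {..<l} X Y \<longrightarrow> eval Y p xs y"
proof (induction rule: eval.induct)
  case (Query x xs)
  have "eval Y Query (x # xs) (of_bool (x \<in> X))" if "agree_on {..<Suc x} X Y" for Y
    using eval.Query[of Y x xs] that by (simp add: agree_on_def)
  then show ?case by blast
next
  case (Comp ys gs xs p z)
  let ?P = "\<lambda>i l. \<forall>Y. agree_on {..<l} X Y \<longrightarrow> eval Y (gs ! i) xs (ys ! i)"
  have "\<exists>b. \<forall>s\<ge>b. ?P i s" if "i < length gs" for i
    using Comp.IH(1)[OF that] by (meson agree_on_mono lessThan_subset_iff)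
  from ex_bound_common[of "length gs" ?P, OF this]
  obtain l1 where l1: "\<And>i s. i < length gs \<Longrightarrow> l1 \<le> s \<Longrightarrow> ?P i s" by blast
  obtain l2 where l2: "\<And>Y. agree_on {..<l2} X Y \<Longrightarrow> eval Y p ys z"
    using Comp.IH(2) by blast
  have "eval Y (Comp p gs) xs z" if Y: "agree_on {..<max l1 l2} X Y" for Y
  proof (rule eval.Comp[OF Comp.hyps(1)])
    show "eval Y (gs ! i) xs (ys ! i)" if "i < length gs" for i
      using l1[OF that max.cobounded1] Y by blast
    show "eval Y p ys z" by (rule l2[OF agree_on_mono[OF Y]]) auto
  qed
  then show ?case by blast
next
  case (PRec_Suc p q n xs r y)
  then obtain l1 l2 where l:
    "\<And>Y. agree_on {..<l1} X Y \<Longrightarrow> eval Y (PRec p q) (n # xs) r"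
    "\<And>Y. agree_on {..<l2} X Y \<Longrightarrow> eval Y q (r # n # xs) y"
    by blast
  have "eval Y (PRec p q) (Suc n # xs) y" if Y: "agree_on {..<max l1 l2} X Y" for Y
    by (rule eval.PRec_Suc[OF l(1)[OF agree_on_mono[OF Y]] l(2)[OF agree_on_mono[OF Y]]]) auto
  then show ?case by blast
next
  case (Mu p n xs)
  let ?P = "\<lambda>m l. \<forall>Y. agree_on {..<l} X Y \<longrightarrow> (\<exists>k. eval Y p (m # xs) (Suc k))"
  have "\<exists>b. \<forall>s\<ge>b. ?P m s" if "m < n" for m
    using Mu.IH(2)[OF that] by (meson agree_on_mono lessThan_subset_iff)
  from ex_bound_common[of n ?P, OF this]
  obtain l1 where l1: "\<And>m s. m < n \<Longrightarrow> l1 \<le> s \<Longrightarrow> ?P m s" by blast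
  obtain l2 where l2: "\<And>Y. agree_on {..<l2} X Y \<Longrightarrow> eval Y p (n # xs) 0"
    using Mu.IH(1) by blast
  have "eval Y (Mu p) xs n" if Y: "agree_on {..<max l1 l2} X Y" for Y
  proof (rule eval.Mu)
    show "eval Y p (n # xs) 0" by (rule l2[OF agree_on_mono[OF Y]]) auto
    show "\<exists>k. eval Y p (m # xs) (Suc k)" if "m < n" for m
      using l1[OF that max.cobounded1] Y by blast
  qed
  then show ?case by blast
qed (auto intro: eval.intros)

text \<open>
  If every oracle of the family that lets \<open>p\<close> halt on \<open>x\<close> makes it decide \<open>x \<in> D\<close> correctly, then
  dovetailing over the family decides \<open>D\<close>.
\<close>

lemma turing_le_if_family_decides:
  fixes Z :: "nat \<Rightarrow> nat set"
  assumes Z: "computes_from X [fst, snd] (\<lambda>z. of_bool (snd z \<in> Z (fst z)))"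
    and halts: "\<And>x. \<exists>t y. eval (Z t) p [x] y"
    and correct: "\<And>x t y. eval (Z t) p [x] y \<Longrightarrow> y = of_bool (x \<in> D)"
  shows "turing_le D X"
proof -
  \<comment> \<open>\<open>w\<close> pairs the fuel with the index of an oracle, so that one search
    dovetails over both.\<close>
  let ?B = "\<lambda>x w. option_encode (bounded_eval (Z (snd (prod_decode w))) (fst (prod_decode w)) p [x])"
  let ?w = "\<lambda>x. LEAST w. 0 < ?B x w"
  have B: "computes_from X vs (\<lambda>a. ?B (f a) (g a))"
    if "computes_from X vs f" "computes_from X vs g" for vs :: "('a \<Rightarrow> nat) list" and f g
  proof (rule cf_subst[OF cf_bounded_eval[OF Z], of vs
        "\<lambda>a. (fst (prod_decode (g a)), snd (prod_decode (g a)), [f a])", unfolded fst_conv snd_conv])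
    show "computes_from X vs (\<lambda>a. u (fst (prod_decode (g a)), snd (prod_decode (g a)), [f a]))"
      if "u \<in> set [fst, \<lambda>z. fst (snd z), \<lambda>z. list_encode (snd (snd z))]" for u
      using that \<open>computes_from X vs f\<close> \<open>computes_from X vs g\<close> by (auto intro!: cf_intros)
  qed
  have ex: "\<exists>w. 0 < ?B x w" for x
  proof -
    obtain t y s where "bounded_eval (Z t) s p [x] = Some y"
      using halts eval_iff_bounded_eval by blast
    then show ?thesis by (intro exI[of _ "prod_encode (s, t)"]) simp
  qed
  have "computes_from X [\<lambda>x. x] (\<lambda>x. ?B x (?w x) - 1)"
    by (intro cf_pred B cf_Least cf_less cf_const ex) (auto intro: cf_var)
  moreover have "?B x (?w x) - 1 = of_bool (x \<in> D)" for x
  proof -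
    have "0 < ?B x (?w x)" using LeastI_ex[OF ex] .
    then obtain y where "bounded_eval (Z (snd (prod_decode (?w x)))) (fst (prod_decode (?w x))) p [x] = Some y"
      by (cases "bounded_eval (Z (snd (prod_decode (?w x)))) (fst (prod_decode (?w x))) p [x]") auto
    then show ?thesis using correct eval_if_bounded_eval by fastforce
  qed
  ultimately show ?thesis by (simp add: turing_le_def computes_from_single)
qed

text \<open>The part of an oracle decided at stage \<open>n\<close>: an initial segment and finitely many columns.\<close>

definition committed :: "nat \<Rightarrow> nat \<Rightarrow> nat set" where
  "committed l n = {x. x < l \<or> fst (prod_decode x) < n}"

text \<open>The sets \<open>Z t\<close> respect the commitments of \<open>C\<close> and are finite
  elsewhere. If \<open>p\<close> gives a wrong answer with one of them, a longer initial segment of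
  it preserves that computation. Otherwise every answer obtained from the family is right; if
  answers existed for all inputs, they would decide \<open>D\<close> from \<open>X\<close>. So on
  some \<open>x\<close> no \<open>Z t\<close> makes \<open>p\<close> halt, and then no set at all
  that respects the commitments does.\<close>

lemma force_requirement:
  assumes CX: "turing_le C X" and DX: "\<not> turing_le D X"
  shows "\<exists>C' l'. turing_le C' X \<and> l \<le> l' \<and> agree_on (committed l n) C C' \<and>
    (\<forall>Y. agree_on (committed l' n) C' Y \<longrightarrow> \<not> (\<forall>x. eval Y p [x] (of_bool (x \<in> D))))"
proof -
  define Z where "Z = (\<lambda>t. {x. if x \<in> committed l n then x \<in> C else x \<in> set (list_decode t)})"
  have C: "computes_from X vs (\<lambda>a. of_bool (f a \<in> C))" if "computes_from X vs f"
    for vs :: "('a \<Rightarrow> nat) list" and f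
    by (rule cf_unary) (use CX that in \<open>auto simp: turing_le_def\<close>)
  have Z_comp: "computes_from X [fst, snd] (\<lambda>z. of_bool (snd z \<in> Z (fst z)))"
  proof -
    have "computes_from X [fst, snd] (\<lambda>z. if snd z < l \<or> fst (prod_decode (snd z)) < n
        then of_bool (snd z \<in> C) else of_bool (snd z \<in> set (list_decode (fst z))))"
      by (intro cf_if cf_disj cf_less cf_const cf_fst_decode C cf_in_set) (simp_all add: cf_var)
    then show ?thesis by (simp add: Z_def committed_def if_distrib[of of_bool])
  qed
  have Z_le: "turing_le (Z t) X" for t
    unfolding turing_le_def computes_from_single[symmetric]
    by (rule cf_binary[OF Z_comp]) (simp_all add: cf_const cf_var)
  have Z_agree: "agree_on (committed l n) C (Z t)" for t
    by (auto simp: agree_on_def Z_def)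
  \<comment> \<open>Off the committed part only the elements of \<open>Y\<close> below the use
    matter. They form a finite set, which has a code \<open>t\<close>.\<close>
  have approx: "\<exists>t. eval (Z t) p [x] y" if ev: "eval Y p [x] y" and Y: "agree_on (committed l n) C Y" for Y x y
  proof -
    obtain b where b: "\<And>Y'. agree_on {..<b} Y Y' \<Longrightarrow> eval Y' p [x] y"
      using use_principle[OF ev] by blast
    obtain zs where zs: "set zs = Y \<inter> {..<b}" using finite_list[of "Y \<inter> {..<b}"] by auto
    have "eval (Z (list_encode zs)) p [x] y"
      by (rule b) (use Y in \<open>auto simp: Z_def zs agree_on_def\<close>)
    then show ?thesis ..
  qed
  show ?thesis
  proof (cases "\<exists>x t y. eval (Z t) p [x] y \<and> y \<noteq> of_bool (x \<in> D)")
    case True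
    then obtain x t y where y: "eval (Z t) p [x] y" "y \<noteq> of_bool (x \<in> D)" by blast
    obtain b where b: "\<And>Y. agree_on {..<b} (Z t) Y \<Longrightarrow> eval Y p [x] y"
      using use_principle[OF y(1)] by blast
    have "\<not> (\<forall>x. eval Y p [x] (of_bool (x \<in> D)))" if "agree_on (committed (max l b) n) (Z t) Y" for Y
    proof -
      have "eval Y p [x] y" by (rule b) (use that in \<open>auto simp: agree_on_def committed_def\<close>)
      then show ?thesis using y(2) eval_deterministic by blast
    qed
    then show ?thesis using Z_le[of t] Z_agree[of t] by (meson max.cobounded1)
  next
    case False
    then have "\<not> (\<forall>x. \<exists>t y. eval (Z t) p [x] y)"
      using turing_le_if_family_decides[OF Z_comp, of p D] DX by blast
    then obtain x where x: "\<And>t y. \<not> eval (Z t) p [x] y" by blast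
    have "\<not> (\<forall>x. eval Y p [x] (of_bool (x \<in> D)))" if "agree_on (committed l n) C Y" for Y
      using approx[OF _ that] x by blast
    moreover have "agree_on (committed l n) C C" by (simp add: agree_on_def)
    ultimately show ?thesis using CX by blast
  qed
qed

text \<open>Stage \<open>n\<close> keeps program number \<open>n\<close> from computing
  \<open>D\<close> and then fills column \<open>n\<close> with \<open>J n\<close> from some point
  on. By then only columns up to \<open>n\<close> are filled, all of them computable from
  \<open>J n\<close> because the sets form a chain. So every stage stays below a member of the
  chain, as \<open>force_requirement\<close> demands, although the limit lies above all of
  them.\<close>

lemma chain_upper_bound_avoiding:
  assumes chain: "\<And>n. turing_le (J n) (J (Suc n))" and D: "\<And>n. \<not> turing_le D (J n)"
  shows "\<exists>C. (\<forall>n. turing_le (J n) C) \<and> \<not> turing_le D C"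
proof -
  define Q where "Q = (\<lambda>n (s :: nat set \<times> nat) s'. snd s < snd s' \<and>
    agree_on (committed (snd s) n) (fst s) (fst s') \<and>
    (\<forall>z. snd s' \<le> prod_encode (n, z) \<longrightarrow> (prod_encode (n, z) \<in> fst s' \<longleftrightarrow> z \<in> J n)) \<and>
    (\<forall>Y. agree_on (committed (snd s') (Suc n)) (fst s') Y \<longrightarrow>
      \<not> (\<forall>x. eval Y (from_nat n) [x] (of_bool (x \<in> D)))))"
  have "\<exists>S. \<forall>n. turing_le (fst (S n)) (J n) \<and> Q n (S n) (S (Suc n))"
  proof (rule dependent_nat_choice)
    show "\<exists>s. turing_le (fst s) (J 0)"
      using turing_le_empty by (metis fst_conv)
    fix s :: "nat set \<times> nat" and n
    assume "turing_le (fst s) (J n)"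
    from force_requirement[OF this D, of "snd s" n "from_nat n"]
    obtain C l where C: "turing_le C (J n)" "snd s \<le> l" "agree_on (committed (snd s) n) (fst s) C"
      and req: "\<And>Y. agree_on (committed l n) C Y \<Longrightarrow>
        \<not> (\<forall>x. eval Y (from_nat n) [x] (of_bool (x \<in> D)))"
      by blast
    \<comment> \<open>Entries up to \<open>l\<close> keep their values, so the requirement just met
      survives the filling of column \<open>n\<close>. The new length is \<open>Suc l\<close>
      because \<open>l\<close> may equal the old one, and lengths must grow strictly for the limit
      to be determined everywhere.\<close>
    define C' where "C' = {x. if l < x \<and> fst (prod_decode x) = n
      then snd (prod_decode x) \<in> J n else x \<in> C}"
    have "computes_from (J n) [\<lambda>x. x] (\<lambda>x. if l < x \<and> fst (prod_decode x) = n
      then of_bool (snd (prod_decode x) \<in> J n) else of_bool (x \<in> C))"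
      by (intro cf_intros cf_oracle cf_unary[OF C(1)[unfolded turing_le_def]]) (simp_all add: cf_var)
    then have "turing_le C' (J n)"
      by (simp add: C'_def turing_le_def computes_from_single if_distrib[of of_bool])
    then have "turing_le C' (J (Suc n))" using chain turing_le_trans by blast
    moreover have "Q n s (C', Suc l)"
      unfolding Q_def
    proof (intro conjI allI impI)
      show "agree_on (committed (snd s) n) (fst s) (fst (C', Suc l))"
        using C(2,3) by (auto simp: agree_on_def committed_def C'_def)
      fix Y assume Y: "agree_on (committed (snd (C', Suc l)) (Suc n)) (fst (C', Suc l)) Y"
      have "x \<in> C \<longleftrightarrow> x \<in> Y" if "x \<in> committed l n" for x
      proof -
        have "x \<in> committed (Suc l) (Suc n)" "x \<in> C' \<longleftrightarrow> x \<in> C"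
          using that by (auto simp: committed_def C'_def)
        then show ?thesis using Y by (simp add: agree_on_def)
      qed
      then have "agree_on (committed l n) C Y" by (simp add: agree_on_def)
      then show "\<not> (\<forall>x. eval Y (from_nat n) [x] (of_bool (x \<in> D)))" by (rule req)
    qed (use C(2) in \<open>auto simp: C'_def\<close>)
    ultimately show "\<exists>s'. turing_le (fst s') (J (Suc n)) \<and> Q n s s'" by (metis fst_conv)
  qed
  then obtain S where Q: "\<And>n. Q n (S n) (S (Suc n))" by blast
  define c where "c n = fst (S n)" for n
  define l where "l n = snd (S n)" for n
  note Q' = Q[unfolded Q_def, folded c_def l_def]
  have l: "n \<le> l n" for n
    by (induction n) (use Q' in \<open>auto simp: Suc_le_eq intro: le_less_trans\<close>)
  have l_mono: "l n \<le> l m" if "n \<le> m" for n m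
    by (rule lift_Suc_mono_le[OF _ that]) (use Q' less_imp_le in blast)
  have agree: "agree_on (committed (l n) n) (c n) (c m)" if "n \<le> m" for n m
    using that
  proof (induction rule: dec_induct)
    case (step m)
    have "committed (l n) n \<subseteq> committed (l m) m"
      using l_mono[OF step.hyps(1)] step.hyps(1) by (auto simp: committed_def)
    moreover have "agree_on (committed (l m) m) (c m) (c (Suc m))" using Q' by blast
    ultimately show ?case using step.IH by (auto simp: agree_on_def)
  qed (simp add: agree_on_def)
  \<comment> \<open>A diagonal limit: at stage \<open>Suc x\<close> the length exceeds
    \<open>x\<close>, so membership of \<open>x\<close> is settled by then.\<close>
  define C where "C = {x. x \<in> c (Suc x)}"
  have C: "agree_on (committed (l n) n) (c n) C" for n
    unfolding agree_on_def
  proof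
    fix x assume x: "x \<in> committed (l n) n"
    show "x \<in> c n \<longleftrightarrow> x \<in> C"
    proof (cases "n \<le> Suc x")
      case True
      then show ?thesis using agree[OF True] x by (simp add: agree_on_def C_def)
    next
      case False
      have "x \<in> committed (l (Suc x)) (Suc x)"
        using l[of "Suc x"] by (simp add: committed_def)
      then show ?thesis using agree[of "Suc x" n] False by (simp add: agree_on_def C_def)
    qed
  qed
  have "turing_le (J n) C" for n
  proof -
    \<comment> \<open>Column \<open>n\<close> can differ from \<open>J n\<close> only at codes below
      \<open>l (Suc n)\<close>; the reduction hard-wires this finite part.\<close>
    let ?F = "J n \<inter> {z. prod_encode (n, z) < l (Suc n)}"
    have "?F \<subseteq> {..<l (Suc n)}" using le_prod_encode_2 le_less_trans by fastforce
    then have fin: "finite ?F" using finite_subset by blast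
    have col: "z \<in> J n \<longleftrightarrow> prod_encode (n, z) \<in> C" if "\<not> prod_encode (n, z) < l (Suc n)" for z
    proof -
      have "prod_encode (n, z) \<in> committed (l (Suc n)) (Suc n)" by (simp add: committed_def)
      then have "prod_encode (n, z) \<in> c (Suc n) \<longleftrightarrow> prod_encode (n, z) \<in> C"
        using C[of "Suc n"] by (simp add: agree_on_def)
      moreover have "prod_encode (n, z) \<in> c (Suc n) \<longleftrightarrow> z \<in> J n"
        using Q'[of n] that not_less by blast
      ultimately show ?thesis by blast
    qed
    have "computes_from C [\<lambda>z. z] (\<lambda>z. if prod_encode (n, z) < l (Suc n)
      then of_bool (z \<in> ?F) else of_bool (prod_encode (n, z) \<in> C))"
      by (intro cf_intros cf_oracle cf_finite[OF fin]) (simp_all add: cf_var)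
    moreover have "(if prod_encode (n, z) < l (Suc n) then of_bool (z \<in> ?F)
        else of_bool (prod_encode (n, z) \<in> C)) = (of_bool (z \<in> J n) :: nat)" for z
      using col[of z] by simp
    ultimately show ?thesis by (simp only: turing_le_def computes_from_single)
  qed
  moreover have "\<not> turing_le D C"
  proof
    assume "turing_le D C"
    then obtain p where "\<forall>x. eval C p [x] (of_bool (x \<in> D))"
      unfolding turing_le_def computes_def by blast
    moreover have "from_nat (to_nat p) = p" by simp
    ultimately show False using Q' C by metis
  qed
  ultimately show ?thesis by blast
qed


section \<open>Intersections of finitely generated sets of degrees\<close>

definition function_graph :: "(nat \<Rightarrow> nat) \<Rightarrow> nat set" where
  "function_graph f = {z. f (fst (prod_decode z)) = snd (prod_decode z)}"

text \<open>A value of a total function is found by searching its graph. The degree of the graph is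
  therefore the least degree computing the function, and the degrees computing one fixed isomorphism
  form a cone.\<close>

lemma computes_iff_turing_le_graph: "computes X f \<longleftrightarrow> turing_le (function_graph f) X"
proof
  assume f: "computes X f"
  have "computes_from X [\<lambda>z. z]
      (\<lambda>z. of_bool (f (fst (prod_decode z)) = snd (prod_decode z)))"
    by (intro cf_eq cf_unary[OF f] cf_fst_decode cf_snd_decode) (simp_all add: cf_var)
  then show "turing_le (function_graph f) X"
    by (simp add: turing_le_def function_graph_def computes_from_single)
next
  assume G: "turing_le (function_graph f) X"
  have "computes_from X [\<lambda>x. x] (\<lambda>x. LEAST y. prod_encode (x, y) \<in> function_graph f)"
    by (intro cf_Least cf_unary[OF G[unfolded turing_le_def]] cf_prod_encode)
      (auto simp: function_graph_def intro: cf_var)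
  moreover have "(LEAST y. prod_encode (x, y) \<in> function_graph f) = f x" for x
    by (rule Least_equality) (auto simp: function_graph_def)
  ultimately show "computes X f" by (simp add: computes_from_single)
qed

lemma degree_computes_iff: "degree_computes c f \<longleftrightarrow> abs_turing_degree (function_graph f) \<le> c"
  by (induction c rule: turing_degree.abs_induct)
    (simp add: degree_computes.abs_eq less_eq_turing_degree.abs_eq computes_iff_turing_le_graph)

lemma finitely_generated_IsoSpec:
  assumes "finite {f. struct_iso f A B}"
  shows "finitely_generated (IsoSpec A B)"
proof -
  have "IsoSpec A B = (\<Union>e\<in>(\<lambda>f. abs_turing_degree (function_graph f)) ` {f. struct_iso f A B}. {e..})"
    by (auto simp: IsoSpec_def degree_computes_iff)
  then show ?thesis unfolding finitely_generated_def using assms by blast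
qed

lemma ex_degree_join:
  fixes a b :: turing_degree
  shows "\<exists>e. \<forall>c. e \<le> c \<longleftrightarrow> a \<le> c \<and> b \<le> c"
proof (induction a rule: turing_degree.abs_induct, induction b rule: turing_degree.abs_induct)
  fix X Y :: "nat set"
  \<comment> \<open>A form of the usual effective join: column 0 plays the part of the even numbers
    and all other columns that of the odd ones.\<close>
  define J where "J = {z. if fst (prod_decode z) = 0 then snd (prod_decode z) \<in> X
    else snd (prod_decode z) \<in> Y}"
  have "turing_le J Z \<longleftrightarrow> turing_le X Z \<and> turing_le Y Z" for Z
  proof safe
    assume J: "turing_le J Z"
    have *: "computes_from Z [\<lambda>x. x] (\<lambda>x. of_bool (prod_encode (k, x) \<in> J))" for k
      by (intro cf_unary[OF J[unfolded turing_le_def]] cf_prod_encode cf_const) (simp add: cf_var)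
    show "turing_le X Z" "turing_le Y Z"
      using *[of 0] *[of 1] by (simp_all add: turing_le_def computes_from_single J_def)
  next
    assume "turing_le X Z" "turing_le Y Z"
    then have "computes_from Z [\<lambda>z. z] (\<lambda>z. if fst (prod_decode z) = 0
        then of_bool (snd (prod_decode z) \<in> X) else of_bool (snd (prod_decode z) \<in> Y))"
      unfolding turing_le_def
      by (intro cf_if cf_eq cf_const cf_fst_decode cf_unary[of Z "\<lambda>n. of_bool (n \<in> X)"]
          cf_unary[of Z "\<lambda>n. of_bool (n \<in> Y)"] cf_snd_decode) (simp_all add: cf_var)
    then show "turing_le J Z"
      by (simp add: J_def turing_le_def computes_from_single if_distrib[of of_bool])
  qed
  then have "abs_turing_degree J \<le> c \<longleftrightarrow> abs_turing_degree X \<le> c \<and> abs_turing_degree Y \<le> c" for c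
    by (induction c rule: turing_degree.abs_induct) (simp add: less_eq_turing_degree.abs_eq)
  then show "\<exists>e. \<forall>c. e \<le> c \<longleftrightarrow> abs_turing_degree X \<le> c \<and> abs_turing_degree Y \<le> c" by blast
qed

lemma degree_chain_upper_bound_avoiding:
  fixes j :: "nat \<Rightarrow> turing_degree"
  assumes "\<And>n. j n \<le> j (Suc n)" and "\<And>n. \<not> d \<le> j n"
  shows "\<exists>c. (\<forall>n. j n \<le> c) \<and> \<not> d \<le> c"
proof -
  obtain C where C: "\<And>n. turing_le (rep_turing_degree (j n)) C" "\<not> turing_le (rep_turing_degree d) C"
    using chain_upper_bound_avoiding[of "\<lambda>n. rep_turing_degree (j n)" "rep_turing_degree d"] assms
    unfolding less_eq_turing_degree.rep_eq by blast
  have "e \<le> abs_turing_degree C \<longleftrightarrow> turing_le (rep_turing_degree e) C" for e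
    using less_eq_turing_degree.abs_eq[of "rep_turing_degree e" C]
    by (simp add: Quotient_abs_rep[OF Quotient_turing_degree])
  then show ?thesis using C by blast
qed

text \<open>
  Koenig's lemma on the tree of choices of one generator for each member of the family: a branch
  whose finite joins are not above \<open>d\<close> would have an upper bound not above \<open>d\<close>.
\<close>

lemma cone_eq_finite_Inter:
  fixes S :: "nat \<Rightarrow> turing_degree set"
  assumes fg: "\<And>i. finitely_generated (S i)" and cone: "(\<Inter>i. S i) = {d..}"
  shows "\<exists>n. (\<Inter>i<n. S i) = {d..}"
proof (rule ccontr)
  assume no: "\<nexists>n. (\<Inter>i<n. S i) = {d..}"
  \<comment> \<open>Corresponds to an infinite subtree in Koenig's lemma: above \<open>j\<close>, no
    finite number of the sets \<open>S i\<close> forces its common members above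
    \<open>d\<close>.\<close>
  define good where "good = (\<lambda>j. \<forall>n. \<exists>c\<ge>j. (\<forall>i<n. c \<in> S i) \<and> \<not> d \<le> c)"
  have step: "\<exists>j'\<ge>j. good j' \<and> {j'..} \<subseteq> S i" if "good j" for i j
  proof (rule ccontr)
    assume no_step: "\<not> (\<exists>j'\<ge>j. good j' \<and> {j'..} \<subseteq> S i)"
    obtain D where D: "finite D" "S i = (\<Union>e\<in>D. {e..})"
      using fg unfolding finitely_generated_def by blast
    \<comment> \<open>A step down the tree joins \<open>j\<close> with a generator \<open>e\<close>
      of \<open>S i\<close>. If every such join is bad, each \<open>e\<close> comes with a bound,
      and there are finitely many of them.\<close>
    have "\<exists>n. \<forall>c. j \<le> c \<and> e \<le> c \<and> (\<forall>i<n. c \<in> S i) \<longrightarrow> d \<le> c" if "e \<in> D" for e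
    proof -
      obtain j' where j': "\<And>c. j' \<le> c \<longleftrightarrow> j \<le> c \<and> e \<le> c" using ex_degree_join by metis
      then have "j \<le> j'" "{j'..} \<subseteq> S i" using D(2) \<open>e \<in> D\<close> by auto
      then have "\<not> good j'" using no_step by blast
      then show ?thesis unfolding good_def j' by blast
    qed
    then obtain N where N: "\<And>e c. e \<in> D \<Longrightarrow> j \<le> c \<Longrightarrow> e \<le> c \<Longrightarrow> (\<forall>i<N e. c \<in> S i) \<Longrightarrow> d \<le> c"
      by metis
    \<comment> \<open>\<open>Suc i\<close> puts \<open>c\<close> into \<open>S i\<close>, hence
      above some generator \<open>e\<close>; the bound of that \<open>e\<close> then yields the
      contradiction.\<close>
    obtain c where c: "j \<le> c" "\<And>k. k < Max (insert (Suc i) (N ` D)) \<Longrightarrow> c \<in> S k" "\<not> d \<le> c"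
      using \<open>good j\<close> unfolding good_def by blast
    have "c \<in> S i" using D(1) by (intro c(2)) (auto simp: Max_gr_iff)
    then obtain e where e: "e \<in> D" "e \<le> c" using D(2) by auto
    have "c \<in> S k" if "k < N e" for k
      using D(1) e(1) that by (intro c(2)) (auto simp: Max_gr_iff)
    then show False using N[OF e(1) c(1) e(2)] c(3) by blast
  qed
  have "\<exists>j. \<forall>n. good (j n) \<and> j n \<le> j (Suc n) \<and> {j (Suc n)..} \<subseteq> S n"
  proof (rule dependent_nat_choice)
    \<comment> \<open>The cone lies in every finite intersection, so a failing equality leaves a
      member that is not above \<open>d\<close>. The root of the tree is the least degree.\<close>
    have "\<exists>c. (\<forall>i<n. c \<in> S i) \<and> \<not> d \<le> c" for n
    proof -
      have "{d..} \<subseteq> (\<Inter>i<n. S i)" using cone by blast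
      then have "\<not> (\<Inter>i<n. S i) \<subseteq> {d..}" using no by (metis subset_antisym)
      then show ?thesis by auto
    qed
    moreover have "abs_turing_degree {} \<le> c" for c
      by (induction c rule: turing_degree.abs_induct)
        (simp add: less_eq_turing_degree.abs_eq turing_le_empty)
    ultimately show "\<exists>j. good j" unfolding good_def by blast
  qed (use step in blast)
  then obtain j where j: "\<And>n. good (j n)" "\<And>n. j n \<le> j (Suc n)" "\<And>n. {j (Suc n)..} \<subseteq> S n"
    by blast
  have "\<not> d \<le> j n" for n using j(1)[of n] unfolding good_def by (meson order_trans)
  then obtain c where c: "\<And>n. j n \<le> c" "\<not> d \<le> c"
    using degree_chain_upper_bound_avoiding j(2) by metis
  have "c \<in> (\<Inter>i. S i)" using c(1) j(3) by auto
  then show False using c(2) cone by auto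
qed


section \<open>Isomorphisms and their inverses and composites\<close>

text \<open>
  A structure is recoded as a relational one whose symbols are the pairs \<open>(r, i)\<close>: for \<open>r = 0\<close> the
  universe as a unary relation, for \<open>r = 1\<close> the relation \<open>i\<close>, for \<open>r \<ge> 2\<close> the graph of the
  function \<open>i\<close>, value first.
\<close>

definition graph_arity :: "struct \<Rightarrow> nat \<Rightarrow> nat option" where
  "graph_arity A t = (case prod_decode t of (r, i) \<Rightarrow>
    if r = 0 then Some 1 else if r = 1 then rel_arity A i else map_option Suc (fun_arity A i))"

definition graph_interp :: "struct \<Rightarrow> nat \<Rightarrow> nat list set" where
  "graph_interp A t = (case prod_decode t of (r, i) \<Rightarrow>
    if r = 0 then {[x] | x. x \<in> universe A} else if r = 1 then rel_interp A i
    else {y # xs | y xs. fun_interp A i xs = Some y})"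

lemma graph_arity_eqI:
  "rel_arity A = rel_arity B \<Longrightarrow> fun_arity A = fun_arity B \<Longrightarrow> graph_arity A = graph_arity B"
  by (auto simp: graph_arity_def fun_eq_iff split: prod.split)

lemma wf_rel_interp:
  assumes "wf_struct A" "xs \<in> rel_interp A i"
  shows "\<exists>n. rel_arity A i = Some n \<and> xs \<in> tuples (universe A) n"
proof -
  have "case rel_arity A i of None \<Rightarrow> rel_interp A i = {}
      | Some n \<Rightarrow> rel_interp A i \<subseteq> tuples (universe A) n"
    using assms(1) unfolding wf_struct_def by blast
  then show ?thesis using assms(2) by (auto split: option.splits)
qed

lemma wf_fun_interp:
  assumes "wf_struct A" "fun_interp A i xs = Some y"
  shows "\<exists>n. fun_arity A i = Some n \<and> xs \<in> tuples (universe A) n" and "y \<in> universe A"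
proof -
  have "case fun_arity A i of None \<Rightarrow> fun_interp A i = Map.empty
      | Some n \<Rightarrow> dom (fun_interp A i) = tuples (universe A) n \<and> ran (fun_interp A i) \<subseteq> universe A"
    using assms(1) unfolding wf_struct_def by blast
  then show "\<exists>n. fun_arity A i = Some n \<and> xs \<in> tuples (universe A) n" "y \<in> universe A"
    using assms(2) by (auto split: option.splits intro: ranI)
qed

lemma wf_fun_interp_defined:
  assumes "wf_struct A" "fun_arity A i = Some n" "xs \<in> tuples (universe A) n"
  shows "\<exists>y\<in>universe A. fun_interp A i xs = Some y"
proof -
  have "case fun_arity A i of None \<Rightarrow> fun_interp A i = Map.empty
      | Some n \<Rightarrow> dom (fun_interp A i) = tuples (universe A) n \<and> ran (fun_interp A i) \<subseteq> universe A"
    using assms(1) unfolding wf_struct_def by blast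
  then show ?thesis using assms(2,3) by (fastforce intro: ranI)
qed

lemma wf_graph_interp:
  assumes "wf_struct A" "xs \<in> graph_interp A t"
  shows "\<exists>n. graph_arity A t = Some n \<and> xs \<in> tuples (universe A) n"
  using assms wf_rel_interp[OF assms(1)] wf_fun_interp[OF assms(1)]
  by (fastforce simp: graph_interp_def graph_arity_def tuples_def split: prod.splits if_splits)

lemma graph_interp_subset_lists: "wf_struct A \<Longrightarrow> graph_interp A t \<subseteq> lists (universe A)"
  using wf_graph_interp by (fastforce simp: tuples_def)

lemma struct_isoD:
  assumes "struct_iso f A B"
  shows struct_iso_bij: "bij_betw f (universe A) (universe B)"
    and struct_iso_in: "x \<in> universe A \<Longrightarrow> f x \<in> universe B"
    and struct_iso_onto: "y \<in> universe B \<Longrightarrow> \<exists>x\<in>universe A. f x = y"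
    and struct_iso_rel_arity: "rel_arity A = rel_arity B"
    and struct_iso_fun_arity: "fun_arity A = fun_arity B"
proof -
  show bij: "bij_betw f (universe A) (universe B)"
    and "rel_arity A = rel_arity B" "fun_arity A = fun_arity B"
    using assms by (simp_all add: struct_iso_def)
  show "f x \<in> universe B" if "x \<in> universe A"
    by (rule bij_betw_apply[OF bij that])
  show "\<exists>x\<in>universe A. f x = y" if "y \<in> universe B"
    using that bij_betw_imp_surj_on[OF bij] by (metis imageE)
qed

lemma struct_iso_iff_graph:
  assumes A: "wf_struct A" and B: "wf_struct B"
  shows "struct_iso f A B \<longleftrightarrow> f \<in> extensional (universe A) \<and>
    bij_betw f (universe A) (universe B) \<and>
    rel_arity A = rel_arity B \<and> fun_arity A = fun_arity B \<and>
    (\<forall>t. \<forall>xs\<in>lists (universe A). xs \<in> graph_interp A t \<longleftrightarrow> map f xs \<in> graph_interp B t)"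
    (is "?L \<longleftrightarrow> ?R")
proof
  assume L: ?L
  then have bij: "bij_betw f (universe A) (universe B)"
    and ar: "rel_arity A = rel_arity B" "fun_arity A = fun_arity B"
    and R: "\<And>i n xs. rel_arity A i = Some n \<Longrightarrow> xs \<in> tuples (universe A) n \<Longrightarrow>
      xs \<in> rel_interp A i \<longleftrightarrow> map f xs \<in> rel_interp B i"
    and F: "\<And>i n xs. fun_arity A i = Some n \<Longrightarrow> xs \<in> tuples (universe A) n \<Longrightarrow>
      fun_interp B i (map f xs) = map_option f (fun_interp A i xs)"
    unfolding struct_iso_def by auto
  have inj: "f x = f y \<longleftrightarrow> x = y" if "x \<in> universe A" "y \<in> universe A" for x y
    using bij that by (auto simp: bij_betw_def inj_on_def)
  have "xs \<in> graph_interp A t \<longleftrightarrow> map f xs \<in> graph_interp B t" if xs: "set xs \<subseteq> universe A" for t xs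
  proof -
    obtain r i where t: "prod_decode t = (r, i)" by fastforce
    consider "r = 0" | "r = 1" | "r \<noteq> 0" "r \<noteq> 1" by blast
    then show ?thesis
    proof cases
      case 1
      have "f x \<in> universe B" if "x \<in> universe A" for x using bij that by (auto simp: bij_betw_def)
      then show ?thesis using 1 xs by (auto simp: graph_interp_def t map_eq_Cons_conv)
    next
      case 2
      have "rel_arity A i = Some (length xs) \<or> (xs \<notin> rel_interp A i \<and> map f xs \<notin> rel_interp B i)"
        using wf_rel_interp[OF A, of xs i] wf_rel_interp[OF B, of "map f xs" i]
        by (auto simp: ar tuples_def)
      then show ?thesis using 2 xs R[of i "length xs" xs] by (auto simp: graph_interp_def t tuples_def)
    next
      case 3
      show ?thesis
      proof (cases xs)
        case (Cons y zs)
        have "fun_arity A i = Some (length zs) \<or>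
            (fun_interp A i zs \<noteq> Some y \<and> fun_interp B i (map f zs) \<noteq> Some (f y))"
          using wf_fun_interp(1)[OF A, of i zs] wf_fun_interp(1)[OF B, of i "map f zs"]
          by (auto simp: ar tuples_def)
        moreover have "fun_interp A i zs = Some y \<longleftrightarrow> fun_interp B i (map f zs) = Some (f y)"
          if ar: "fun_arity A i = Some (length zs)"
        proof -
          have zs: "zs \<in> tuples (universe A) (length zs)" using xs Cons by (simp add: tuples_def)
          obtain w where "w \<in> universe A" "fun_interp A i zs = Some w"
            using wf_fun_interp_defined[OF A ar zs] by blast
          then show ?thesis using F[OF ar zs] inj xs Cons by auto
        qed
        ultimately show ?thesis using 3 Cons by (auto simp: graph_interp_def t)
      qed (use 3 in \<open>simp add: graph_interp_def t\<close>)
    qed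
  qed
  then show ?R using L unfolding struct_iso_def by auto
next
  assume R: ?R
  have "xs \<in> rel_interp A i \<longleftrightarrow> map f xs \<in> rel_interp B i" if "xs \<in> tuples (universe A) n" for i n xs
  proof -
    have "xs \<in> graph_interp A (prod_encode (1, i)) \<longleftrightarrow> map f xs \<in> graph_interp B (prod_encode (1, i))"
      using R that by (auto simp: tuples_def)
    then show ?thesis by (simp add: graph_interp_def)
  qed
  moreover have "fun_interp B i (map f xs) = map_option f (fun_interp A i xs)"
    if n: "fun_arity A i = Some n" and xs: "xs \<in> tuples (universe A) n" for i n xs
  proof -
    obtain y where y: "y \<in> universe A" "fun_interp A i xs = Some y"
      using wf_fun_interp_defined[OF A n xs] by blast
    then have "y # xs \<in> graph_interp A (prod_encode (2, i))" by (simp add: graph_interp_def)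
    moreover have "y # xs \<in> lists (universe A)" using xs y by (auto simp: tuples_def)
    ultimately have "map f (y # xs) \<in> graph_interp B (prod_encode (2, i))" using R by blast
    then show ?thesis using y by (simp add: graph_interp_def)
  qed
  ultimately show ?L using R unfolding struct_iso_def by blast
qed

lemma struct_iso_compose:
  assumes wf: "wf_struct A" "wf_struct B" "wf_struct C"
    and f: "struct_iso f A B" and g: "struct_iso g B C"
  shows "struct_iso (compose (universe A) g f) A C"
proof -
  note f' = f[unfolded struct_iso_iff_graph[OF wf(1,2)]]
  note g' = g[unfolded struct_iso_iff_graph[OF wf(2,3)]]
  have img: "map f xs \<in> lists (universe B)" if "xs \<in> lists (universe A)" for xs
    using that struct_iso_in[OF f] by auto
  have map: "map (compose (universe A) g f) xs = map g (map f xs)" if "xs \<in> lists (universe A)" for xs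
    using that by (auto simp: compose_def)
  have "bij_betw (compose (universe A) g f) (universe A) (universe C)"
    using f' g' bij_betw_compose by blast
  moreover have "xs \<in> graph_interp A t \<longleftrightarrow> map (compose (universe A) g f) xs \<in> graph_interp C t"
    if xs: "xs \<in> lists (universe A)" for t xs
    unfolding map[OF xs] using f' g' img[OF xs] xs by blast
  ultimately show ?thesis
    unfolding struct_iso_iff_graph[OF wf(1,3)] using f' g' by (auto simp: compose_def)
qed

lemma struct_iso_inverse:
  assumes wf: "wf_struct A" "wf_struct B" and f: "struct_iso f A B"
  shows "struct_iso (restrict (inv_into (universe A) f) (universe B)) B A"
proof -
  let ?g = "restrict (inv_into (universe A) f) (universe B)"
  note f' = f[unfolded struct_iso_iff_graph[OF wf]]
  have bij: "bij_betw ?g (universe B) (universe A)"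
    using f' bij_betw_inv_into bij_betw_restrict_eq by blast
  have map: "map f (map ?g ys) = ys" if "ys \<in> lists (universe B)" for ys
    using that f' by (auto intro!: map_idI simp: bij_betw_def f_inv_into_f)
  have "map ?g ys \<in> lists (universe A)" if "ys \<in> lists (universe B)" for ys
    using that bij_betw_apply[OF bij] by auto
  then have "ys \<in> graph_interp B t \<longleftrightarrow> map ?g ys \<in> graph_interp A t" if "ys \<in> lists (universe B)" for t ys
    using f' map that by metis
  then show ?thesis
    unfolding struct_iso_iff_graph[OF wf(2,1)] using f' bij by auto
qed

section \<open>Effectivity of composites and inverses\<close>

lemma computable_struct_wf: "computable_struct A \<Longrightarrow> wf_struct A"
  by (simp add: computable_struct_def)

lemma cf_universe:
  assumes "computable_struct A" "computes_from X vs f"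
  shows "computes_from X vs (\<lambda>a. of_bool (f a \<in> universe A))"
  by (rule cf_unary[OF computes_if_computable])
    (use assms in \<open>auto simp: computable_struct_def computable_set_def\<close>)

lemma IsoSpec_trans:
  assumes A: "computable_struct A" and B: "computable_struct B" and C: "computable_struct C"
    and d: "d \<in> IsoSpec A B" "d \<in> IsoSpec B C"
  shows "d \<in> IsoSpec A C"
proof -
  obtain f g where f: "struct_iso f A B" "degree_computes d f"
    and g: "struct_iso g B C" "degree_computes d g"
    using d unfolding IsoSpec_def by blast
  have "degree_computes d (compose (universe A) g f)"
    using f(2) g(2)
  proof (induction d rule: turing_degree.abs_induct)
    fix X assume "degree_computes (abs_turing_degree X) f" "degree_computes (abs_turing_degree X) g"
    then have fg: "computes X f" "computes X g" by (simp_all add: degree_computes.abs_eq)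
    have "computes_from X [\<lambda>x. x] (\<lambda>x. if x \<in> universe A then g (f x) else undefined)"
      by (intro cf_if cf_universe A cf_const cf_unary[OF fg(1)] cf_unary[OF fg(2)]) (simp_all add: cf_var)
    then show "degree_computes (abs_turing_degree X) (compose (universe A) g f)"
      by (simp add: degree_computes.abs_eq computes_from_single compose_def restrict_def)
  qed
  then show ?thesis
    using struct_iso_compose f(1) g(1) A B C computable_struct_wf unfolding IsoSpec_def by blast
qed

lemma IsoSpec_sym:
  assumes A: "computable_struct A" and B: "computable_struct B" and d: "d \<in> IsoSpec A B"
  shows "d \<in> IsoSpec B A"
proof -
  obtain f where f: "struct_iso f A B" "degree_computes d f"
    using d unfolding IsoSpec_def by blast
  note iso = f(1)
  let ?U = "universe A" and ?V = "universe B"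
  have bij: "bij_betw f ?U ?V" using f(1) by (simp add: struct_iso_def)
  have "degree_computes d (restrict (inv_into ?U f) ?V)"
    using f(2)
  proof (induction d rule: turing_degree.abs_induct)
    fix X assume "degree_computes (abs_turing_degree X) f"
    then have f: "computes X f" by (simp add: degree_computes.abs_eq)
    \<comment> \<open>Preimages are found by search. The disjunct \<open>y \<notin> ?V\<close> makes
      the search total, and the outer conditional discards what it finds in that case.\<close>
    have "\<exists>x. y \<notin> ?V \<or> x \<in> ?U \<and> f x = y" for y
      using struct_iso_onto[OF iso] by blast
    then have "computes_from X [\<lambda>y. y] (\<lambda>y. if y \<in> ?V then LEAST x. y \<notin> ?V \<or> x \<in> ?U \<and> f x = y else undefined)"
      by (intro cf_if cf_universe A B cf_const cf_Least cf_disj cf_conj cf_not cf_eq cf_unary[OF f])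
        (simp_all add: cf_var)
    moreover have "(if y \<in> ?V then LEAST x. y \<notin> ?V \<or> x \<in> ?U \<and> f x = y else undefined) =
        restrict (inv_into ?U f) ?V y" for y
    proof (cases "y \<in> ?V")
      case True
      then obtain x where x: "x \<in> ?U" "f x = y" using struct_iso_onto[OF iso] by blast
      then have "(LEAST x. y \<notin> ?V \<or> x \<in> ?U \<and> f x = y) = x"
        using True bij by (intro Least_equality) (auto simp: bij_betw_def inj_on_def)
      moreover have "inv_into ?U f y = x" using x bij by (auto simp: bij_betw_def)
      ultimately show ?thesis using True by simp
    qed simp
    ultimately show "degree_computes (abs_turing_degree X) (restrict (inv_into ?U f) ?V)"
      by (simp only: degree_computes.abs_eq computes_from_single)
  qed
  then show ?thesis
    using struct_iso_inverse f(1) A B computable_struct_wf unfolding IsoSpec_def by blast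
qed

lemma isomorphic_trans:
  "wf_struct A \<Longrightarrow> wf_struct B \<Longrightarrow> wf_struct C \<Longrightarrow> isomorphic A B \<Longrightarrow> isomorphic B C \<Longrightarrow> isomorphic A C"
  using struct_iso_compose unfolding isomorphic_def by blast

lemma isomorphic_sym: "wf_struct A \<Longrightarrow> wf_struct B \<Longrightarrow> isomorphic A B \<Longrightarrow> isomorphic B A"
  using struct_iso_inverse unfolding isomorphic_def by blast

text \<open>\<open>CatSpec M\<close> speaks only of isomorphisms that start at \<open>M\<close>; an
  isomorphism of two copies is obtained by going back to \<open>M\<close> and on from there.\<close>

lemma IsoSpec_if_CatSpec:
  assumes M: "computable_struct M" and d: "d \<in> CatSpec M"
    and A: "A \<in> computable_copies M" and B: "B \<in> computable_copies M"
  shows "d \<in> IsoSpec A B"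
proof -
  have "d \<in> IsoSpec M A" "d \<in> IsoSpec M B"
    using d A B by (auto simp: CatSpec_def computably_categorical_def)
  moreover have "computable_struct A" "computable_struct B"
    using A B by (simp_all add: computable_copies_def)
  ultimately show ?thesis using IsoSpec_sym IsoSpec_trans M by blast
qed

text \<open>Composing with a fixed isomorphism on either side injects the isomorphisms from
  \<open>A\<close> to \<open>B\<close> into the automorphisms of \<open>M\<close>.\<close>

lemma finite_isos_if_finite_automorphisms:
  assumes wf: "wf_struct M" "wf_struct A" "wf_struct B"
    and iso: "isomorphic M A" "isomorphic M B" and fin: "finite {f. struct_iso f M M}"
  shows "finite {f. struct_iso f A B}"
proof -
  obtain a b where a: "struct_iso a M A" and b: "struct_iso b B M"
    using iso isomorphic_sym[OF wf(1,3)] unfolding isomorphic_def by blast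
  let ?\<phi> = "\<lambda>f. compose (universe M) b (compose (universe M) f a)"
  have "inj_on ?\<phi> {f. struct_iso f A B}"
  proof (rule inj_onI)
    fix f g assume fg: "f \<in> {f. struct_iso f A B}" "g \<in> {f. struct_iso f A B}" and eq: "?\<phi> f = ?\<phi> g"
    show "f = g"
    proof (rule extensionalityI[of _ "universe A"])
      fix x assume x: "x \<in> universe A"
      then obtain m where m: "m \<in> universe M" "a m = x"
        using struct_iso_onto[OF a] by blast
      have "f x \<in> universe B" "g x \<in> universe B"
        using fg x by (auto simp: struct_iso_def bij_betw_def)
      moreover have "b (f x) = b (g x)" using fun_cong[OF eq, of m] m by (simp add: compose_def)
      ultimately show "f x = g x" using b by (auto simp: struct_iso_def bij_betw_def inj_on_def)
    qed (use fg in \<open>auto simp: struct_iso_def\<close>)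
  qed
  moreover have "?\<phi> ` {f. struct_iso f A B} \<subseteq> {f. struct_iso f M M}"
    using struct_iso_compose[OF wf(1,3,1) struct_iso_compose[OF wf(1,2,3) a] b] by blast
  ultimately show ?thesis using fin by (blast intro: inj_on_finite)
qed


section \<open>Graph diagrams and images of structures\<close>

text \<open>One set that carries the universe, the relations and the functions, so that
  computability of a structure with a computable language becomes decidability of this set.\<close>

definition graph_diagram :: "struct \<Rightarrow> nat set" where
  "graph_diagram A = {prod_encode (t, list_encode xs) | t xs. xs \<in> graph_interp A t}"

lemma mem_graph_diagram_iff:
  "z \<in> graph_diagram A \<longleftrightarrow> list_decode (snd (prod_decode z)) \<in> graph_interp A (fst (prod_decode z))"
proof
  assume "list_decode (snd (prod_decode z)) \<in> graph_interp A (fst (prod_decode z))"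
  moreover have "z = prod_encode (fst (prod_decode z), list_encode (list_decode (snd (prod_decode z))))"
    by simp
  ultimately show "z \<in> graph_diagram A" unfolding graph_diagram_def by blast
qed (auto simp: graph_diagram_def)

lemma cf_mem_graph_interp:
  assumes "computable_set (graph_diagram A)" "computes_from X vs t"
    "computes_from X vs (\<lambda>a. list_encode (xs a))"
  shows "computes_from X vs (\<lambda>a. of_bool (xs a \<in> graph_interp A (t a)))"
proof -
  have "computes_from X vs (\<lambda>a. of_bool (prod_encode (t a, list_encode (xs a)) \<in> graph_diagram A))"
    by (intro cf_unary[OF computes_if_computable[OF assms(1)[unfolded computable_set_def]]]
        cf_prod_encode assms)
  then show ?thesis by (simp add: mem_graph_diagram_iff)
qed

lemma option_encode_eq_Suc_iff: "option_encode x = Suc y \<longleftrightarrow> x = Some y"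
  by (cases x) auto

lemma cf_graph_arity:
  assumes "computable (\<lambda>i. option_encode (rel_arity A i))"
    and "computable (\<lambda>i. option_encode (fun_arity A i))" and f: "computes_from X vs f"
  shows "computes_from X vs (\<lambda>a. option_encode (graph_arity A (f a)))"
proof -
  note ar = assms(1,2)[THEN computes_if_computable, of X]
  \<comment> \<open>\<open>Some n\<close> has code \<open>Suc n\<close>, so the unary universe
    symbol gets 2, and applying \<open>Suc\<close> under \<open>Some\<close> raises a nonzero code
    by one.\<close>
  have *: "option_encode (graph_arity A t) = (if fst (prod_decode t) = 0 then 2
      else if fst (prod_decode t) = 1 then option_encode (rel_arity A (snd (prod_decode t)))
      else if option_encode (fun_arity A (snd (prod_decode t))) = 0 then 0
      else Suc (option_encode (fun_arity A (snd (prod_decode t)))))" for t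
    by (cases "fun_arity A (snd (prod_decode t))") (auto simp: graph_arity_def split: prod.split)
  show ?thesis unfolding * by (intro cf_intros cf_unary[OF ar(1)] cf_unary[OF ar(2)] f)
qed

lemma computable_graph_diagram:
  assumes A: "computable_struct A"
  shows "computable_set (graph_diagram A)"
proof -
  let ?R = "{prod_encode (i, list_encode xs) | i xs. xs \<in> rel_interp A i}"
  let ?F = "\<lambda>n. case prod_decode n of (i, c) \<Rightarrow> option_encode (fun_interp A i (list_decode c))"
  have R: "computes {} (\<lambda>n. of_bool (n \<in> ?R))" and F: "computes {} ?F"
    using A by (simp_all add: computable_struct_def computable_set_def computable_def)
  let ?r = "\<lambda>z. fst (prod_decode (fst (prod_decode z)))"
  let ?i = "\<lambda>z. snd (prod_decode (fst (prod_decode z)))"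
  let ?xs = "\<lambda>z. list_decode (snd (prod_decode z))"
  let ?hd = "\<lambda>z. if ?xs z = [] then 0 else hd (?xs z)"
  have R': "prod_encode (i, list_encode xs) \<in> ?R \<longleftrightarrow> xs \<in> rel_interp A i" for i xs
    by (auto simp: prod_encode_eq list_encode_eq)
  have *: "of_bool (z \<in> graph_diagram A) =
    (if ?r z = 0 then of_bool (?xs z \<noteq> [] \<and> tl (?xs z) = [] \<and> ?hd z \<in> universe A)
     else if ?r z = 1 then of_bool (prod_encode (?i z, list_encode (?xs z)) \<in> ?R)
     else of_bool (?xs z \<noteq> [] \<and> ?F (prod_encode (?i z, list_encode (tl (?xs z)))) = Suc (?hd z)))" for z
    unfolding R'
    by (cases "?xs z")
      (auto simp: mem_graph_diagram_iff graph_interp_def option_encode_eq_Suc_iff split: prod.splits)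
  have xs: "computes_from {} [\<lambda>z. z] (\<lambda>z. list_encode (?xs z))"
    by (simp add: cf_snd_decode cf_var)
  show ?thesis
    unfolding computable_set_def computable_def computes_from_single[symmetric] *
    by (intro cf_intros cf_Nil_test cf_hd cf_tl cf_universe A cf_unary[OF R] cf_unary[OF F] xs)
      (simp_all add: cf_var)
qed

text \<open>A function value is found by searching the graph. Whether there is one is decided
  beforehand from the arity and the universe, because functions of well-formed structures are total
  on their tuples.\<close>

lemma computable_struct_if_graph_diagram:
  assumes wf: "wf_struct A" and ra: "computable (\<lambda>i. option_encode (rel_arity A i))"
    and fa: "computable (\<lambda>i. option_encode (fun_arity A i))"
    and D: "computable_set (graph_diagram A)"
  shows "computable_struct A"
proof -
  note mem = cf_mem_graph_interp[OF D]
  have U: "computes_from {} vs (\<lambda>a. of_bool (f a \<in> universe A))" if "computes_from {} vs f"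
    for vs :: "('a \<Rightarrow> nat) list" and f
  proof -
    have "computes_from {} vs (\<lambda>a. of_bool ([f a] \<in> graph_interp A (prod_encode (0, 0))))"
      by (intro mem cf_const cf_Cons that)
    then show ?thesis by (simp add: graph_interp_def)
  qed
  have "z \<in> {prod_encode (i, list_encode xs) | i xs. xs \<in> rel_interp A i} \<longleftrightarrow>
      list_decode (snd (prod_decode z)) \<in> graph_interp A (prod_encode (1, fst (prod_decode z)))" for z
  proof
    assume "list_decode (snd (prod_decode z)) \<in> graph_interp A (prod_encode (1, fst (prod_decode z)))"
    then have "list_decode (snd (prod_decode z)) \<in> rel_interp A (fst (prod_decode z))"
      by (simp add: graph_interp_def)
    moreover have "z = prod_encode (fst (prod_decode z), list_encode (list_decode (snd (prod_decode z))))"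
      by simp
    ultimately show "z \<in> {prod_encode (i, list_encode xs) | i xs. xs \<in> rel_interp A i}" by blast
  qed (auto simp: graph_interp_def)
  moreover have "computes_from {} [\<lambda>z. z] (\<lambda>z. of_bool (list_decode (snd (prod_decode z)) \<in>
      graph_interp A (prod_encode (1, fst (prod_decode z)))))"
    by (intro mem) (simp_all add: cf_prod_encode cf_const cf_snd_decode cf_fst_decode cf_var)
  ultimately have R: "computable_set {prod_encode (i, list_encode xs) | i xs. xs \<in> rel_interp A i}"
    by (simp only: computable_set_def computable_def computes_from_single)
  let ?i = "\<lambda>n. fst (prod_decode n)" and ?xs = "\<lambda>n. list_decode (snd (prod_decode n))"
  let ?dom = "\<lambda>n. option_encode (fun_arity A (?i n)) = Suc (length (?xs n)) \<and>
    list_all (\<lambda>x. x \<in> universe A) (?xs n)"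
  let ?P = "\<lambda>n y. \<not> ?dom n \<or> y # ?xs n \<in> graph_interp A (prod_encode (2, ?i n))"
  have xs: "computes_from {} [\<lambda>n. n] (\<lambda>n. list_encode (?xs n))"
    by (simp add: cf_snd_decode cf_var)
  have dom: "computes_from {} [\<lambda>n. n] (\<lambda>n. of_bool (?dom n))"
    by (intro cf_conj cf_eq cf_unary[OF fa[unfolded computable_def]] cf_Suc cf_length cf_list_all U
        cf_fst_decode xs) (simp_all add: cf_var)
  have P: "?P n y \<longleftrightarrow> \<not> ?dom n \<or> fun_interp A (?i n) (?xs n) = Some y" for n y
    by (simp add: graph_interp_def)
  have dom_iff: "?dom n \<longleftrightarrow> (\<exists>y. fun_interp A (?i n) (?xs n) = Some y)" for n
    using wf_fun_interp_defined[OF wf, of "?i n" "length (?xs n)" "?xs n"]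
      wf_fun_interp(1)[OF wf, of "?i n" "?xs n"]
    by (auto simp: option_encode_eq_Suc_iff tuples_def list_all_iff)
  have "computes_from {} [\<lambda>n. n] (\<lambda>n. if ?dom n then Suc (LEAST y. ?P n y) else 0)"
  proof (intro cf_if dom cf_Suc cf_const cf_Least cf_disj cf_not mem cf_prod_encode cf_Cons)
    show "\<exists>y. ?P n y" for n unfolding P using dom_iff[of n] by blast
    show "computes_from {} (snd # map (\<lambda>v z. v (fst z)) [\<lambda>n. n]) (\<lambda>z. of_bool (?dom (fst z)))"
      by (rule cf_subst[OF dom]) (simp add: cf_var)
  qed (simp_all add: cf_var cf_fst_decode cf_snd_decode)
  moreover have "(if ?dom n then Suc (LEAST y. ?P n y) else 0) =
      (case prod_decode n of (i, c) \<Rightarrow> option_encode (fun_interp A i (list_decode c)))" for n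
  proof (cases "fun_interp A (?i n) (?xs n)")
    case None
    then have "\<not> ?dom n" using dom_iff[of n] by simp
    then show ?thesis using None by (simp add: case_prod_beta)
  next
    case (Some y)
    then have "?dom n" using dom_iff[of n] by blast
    moreover have "(LEAST y. ?P n y) = y"
      unfolding P using \<open>?dom n\<close> Some by (intro Least_equality) auto
    ultimately show ?thesis using Some by (simp add: case_prod_beta)
  qed
  ultimately have "computable (\<lambda>n. case prod_decode n of
      (i, c) \<Rightarrow> option_encode (fun_interp A i (list_decode c)))"
    by (simp only: computable_def computes_from_single)
  moreover have "computable_set (universe A)"
    unfolding computable_set_def computable_def computes_from_single[symmetric]
    by (rule U) (simp add: cf_var)
  ultimately show ?thesis unfolding computable_struct_def using wf ra fa R by blast
qed

text \<open>Meant for the pieces of a copy of a disjoint union, with \<open>h\<close> a part of the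
  isomorphism onto the copy. Outside the image \<open>inv_into\<close> is arbitrary, whence the
  guard: a well-formed structure has no values there.\<close>

definition image_struct :: "(nat \<Rightarrow> nat) \<Rightarrow> struct \<Rightarrow> struct" where
  "image_struct h A = \<lparr>universe = h ` universe A, rel_arity = rel_arity A, fun_arity = fun_arity A,
    rel_interp = (\<lambda>i. map h ` rel_interp A i),
    fun_interp = (\<lambda>i ys. if set ys \<subseteq> h ` universe A
      then map_option h (fun_interp A i (map (inv_into (universe A) h) ys)) else None)\<rparr>"

lemma image_struct_simps [simp]:
  "universe (image_struct h A) = h ` universe A"
  "rel_arity (image_struct h A) = rel_arity A"
  "fun_arity (image_struct h A) = fun_arity A"
  "rel_interp (image_struct h A) i = map h ` rel_interp A i"
  by (simp_all add: image_struct_def)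

lemma fun_interp_image_struct:
  assumes wf: "wf_struct A" and inj: "inj_on h (universe A)"
  shows "fun_interp (image_struct h A) i ys = Some z \<longleftrightarrow>
    (\<exists>xs y. ys = map h xs \<and> z = h y \<and> fun_interp A i xs = Some y)" (is "?L \<longleftrightarrow> ?R")
proof
  assume ?L
  then have ys: "set ys \<subseteq> h ` universe A"
    and z: "map_option h (fun_interp A i (map (inv_into (universe A) h) ys)) = Some z"
    by (auto simp: image_struct_def split: if_splits)
  have "map h (map (inv_into (universe A) h) ys) = ys"
    using ys by (auto intro!: map_idI simp: f_inv_into_f subset_iff)
  then show ?R using z by (metis map_option_eq_Some)
next
  assume ?R
  then obtain xs y where xs: "ys = map h xs" "z = h y" "fun_interp A i xs = Some y" by blast
  then have "set xs \<subseteq> universe A" using wf_fun_interp(1)[OF wf] by (fastforce simp: tuples_def)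
  then have "map (inv_into (universe A) h) ys = xs"
    unfolding xs(1) map_map using inj by (intro map_idI) (auto simp: subset_iff)
  then show ?L using xs \<open>set xs \<subseteq> universe A\<close> by (auto simp: image_struct_def)
qed

lemma graph_interp_image_struct:
  assumes "wf_struct A" "inj_on h (universe A)"
  shows "graph_interp (image_struct h A) t = map h ` graph_interp A t"
proof -
  obtain r i where t: "prod_decode t = (r, i)" by fastforce
  have singletons: "{[x] | x. x \<in> S} = (\<lambda>x. [x]) ` S" for S :: "nat set" by auto
  have "{y # ys | y ys. fun_interp (image_struct h A) i ys = Some y} =
      {map h (y # xs) | y xs. fun_interp A i xs = Some y}"
    unfolding fun_interp_image_struct[OF assms] by auto
  also have "\<dots> = map h ` {y # xs | y xs. fun_interp A i xs = Some y}" by blast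
  finally show ?thesis by (simp add: graph_interp_def t singletons image_image)
qed

lemma image_struct_iso:
  assumes wf: "wf_struct A" and inj: "inj_on h (universe A)"
  shows wf_image_struct: "wf_struct (image_struct h A)"
    and struct_iso_image_struct: "struct_iso (restrict h (universe A)) A (image_struct h A)"
proof -
  let ?I = "image_struct h A"
  have tup: "map h ` tuples (universe A) n = tuples (h ` universe A) n" for n
  proof
    show "tuples (h ` universe A) n \<subseteq> map h ` tuples (universe A) n"
    proof
      fix ys assume "ys \<in> tuples (h ` universe A) n"
      then have "set ys \<subseteq> h ` universe A" "length ys = n" by (auto simp: tuples_def)
      then have "map h (map (inv_into (universe A) h) ys) = ys"
        "map (inv_into (universe A) h) ys \<in> tuples (universe A) n"
        by (auto intro!: map_idI simp: f_inv_into_f subset_iff tuples_def inv_into_into)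
      then show "ys \<in> map h ` tuples (universe A) n" by (metis imageI)
    qed
  qed (auto simp: tuples_def subset_iff)
  show wfI: "wf_struct ?I"
    unfolding wf_struct_def
  proof (intro conjI allI)
    show "universe ?I \<noteq> {}" using wf by (simp add: wf_struct_def)
    show "case rel_arity ?I i of None \<Rightarrow> rel_interp ?I i = {}
        | Some n \<Rightarrow> rel_interp ?I i \<subseteq> tuples (universe ?I) n" for i
      using wf_rel_interp[OF wf, of _ i] by (fastforce simp flip: tup split: option.split)
    show "case fun_arity ?I i of None \<Rightarrow> fun_interp ?I i = Map.empty
        | Some n \<Rightarrow> dom (fun_interp ?I i) = tuples (universe ?I) n \<and> ran (fun_interp ?I i) \<subseteq> universe ?I"
      for i
    proof (cases "fun_arity A i")
      case None
      have "fun_interp ?I i ys \<noteq> Some z" for ys z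
        unfolding fun_interp_image_struct[OF wf inj] using wf_fun_interp(1)[OF wf] None by fastforce
      then have "fun_interp ?I i = Map.empty" by (meson ext not_Some_eq)
      then show ?thesis using None by simp
    next
      case (Some n)
      have "dom (fun_interp ?I i) = map h ` tuples (universe A) n"
      proof
        show "dom (fun_interp ?I i) \<subseteq> map h ` tuples (universe A) n"
          using wf_fun_interp(1)[OF wf, of i] Some
          by (fastforce simp: dom_def fun_interp_image_struct[OF wf inj])
        show "map h ` tuples (universe A) n \<subseteq> dom (fun_interp ?I i)"
          using wf_fun_interp_defined[OF wf Some]
          by (fastforce simp: dom_def fun_interp_image_struct[OF wf inj])
      qed
      moreover have "ran (fun_interp ?I i) \<subseteq> h ` universe A"
        using wf_fun_interp(2)[OF wf, of i]
        by (fastforce simp: ran_def fun_interp_image_struct[OF wf inj])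
      ultimately show ?thesis using Some tup by simp
    qed
  qed
  show "struct_iso (restrict h (universe A)) A ?I"
    unfolding struct_iso_iff_graph[OF wf wfI]
  proof (intro conjI allI ballI)
    show "bij_betw (restrict h (universe A)) (universe A) (universe ?I)"
      using inj by (simp add: bij_betw_def inj_on_restrict_eq)
    fix t xs assume xs: "xs \<in> lists (universe A)"
    then have h: "map (restrict h (universe A)) xs = map h xs" by auto
    have "map h xs \<in> map h ` graph_interp A t \<longleftrightarrow> xs \<in> graph_interp A t"
    proof
      assume "map h xs \<in> map h ` graph_interp A t"
      then obtain ys where ys: "ys \<in> graph_interp A t" "map h xs = map h ys" by blast
      have "inj_on h (set xs \<union> set ys)"
        using xs ys(1) graph_interp_subset_lists[OF wf, of t] by (intro inj_on_subset[OF inj]) auto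
      then have "xs = ys" using ys(2) map_inj_on by blast
      then show "xs \<in> graph_interp A t" using ys by simp
    qed blast
    then show "xs \<in> graph_interp A t \<longleftrightarrow> map (restrict h (universe A)) xs \<in> graph_interp ?I t"
      unfolding h graph_interp_image_struct[OF wf inj] by blast
  qed auto
qed


section \<open>Labelled disjoint unions\<close>

text \<open>Disjoint unions and their copies have no function symbols and can be compared by their
  relations directly. As before, lists of the wrong length lie in no relation.\<close>

lemma struct_iso_relational:
  assumes A: "wf_struct A" "fun_arity A = Map.empty" and B: "wf_struct B" "fun_arity B = Map.empty"
  shows "struct_iso f A B \<longleftrightarrow> f \<in> extensional (universe A) \<and>
    bij_betw f (universe A) (universe B) \<and> rel_arity A = rel_arity B \<and>
    (\<forall>s. \<forall>xs\<in>lists (universe A). xs \<in> rel_interp A s \<longleftrightarrow> map f xs \<in> rel_interp B s)"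
proof -
  have *: "(\<forall>n. rel_arity A s = Some n \<longrightarrow>
        (\<forall>xs\<in>tuples (universe A) n. xs \<in> rel_interp A s \<longleftrightarrow> map f xs \<in> rel_interp B s)) \<longleftrightarrow>
      (\<forall>xs\<in>lists (universe A). xs \<in> rel_interp A s \<longleftrightarrow> map f xs \<in> rel_interp B s)"
    if ar: "rel_arity A = rel_arity B" for s
  proof
    assume *: "\<forall>n. rel_arity A s = Some n \<longrightarrow>
        (\<forall>xs\<in>tuples (universe A) n. xs \<in> rel_interp A s \<longleftrightarrow> map f xs \<in> rel_interp B s)"
    show "\<forall>xs\<in>lists (universe A). xs \<in> rel_interp A s \<longleftrightarrow> map f xs \<in> rel_interp B s"
    proof
      fix xs assume "xs \<in> lists (universe A)"
      then have xs: "xs \<in> tuples (universe A) (length xs)" by (auto simp: tuples_def)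
      have "rel_arity A s = Some (length xs)" if "xs \<in> rel_interp A s \<or> map f xs \<in> rel_interp B s"
        using that wf_rel_interp[OF A(1), of xs s] wf_rel_interp[OF B(1), of "map f xs" s]
        by (auto simp: ar tuples_def)
      then show "xs \<in> rel_interp A s \<longleftrightarrow> map f xs \<in> rel_interp B s" using * xs by blast
    qed
  qed (auto simp: tuples_def)
  show ?thesis
  proof (cases "rel_arity A = rel_arity B")
    case True
    then show ?thesis unfolding struct_iso_def *[OF True] by (simp add: A(2) B(2))
  qed (simp add: struct_iso_def)
qed

section \<open>The labelled union and its computability\<close>

abbreviation tag :: "nat \<Rightarrow> nat \<Rightarrow> nat" where
  "tag j \<equiv> \<lambda>x. prod_encode (j, x)"

lemma map_tag_eq_iff: "map (tag j) xs = map (tag j) ys \<longleftrightarrow> xs = ys"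
  by (rule inj_map_eq_map) (simp add: inj_def prod_encode_eq)

text \<open>Symbol \<open>(j, t)\<close> is the graph symbol \<open>t\<close> of component
  \<open>j\<close>. The graph symbols of the universe thus provide a unary relation naming each
  component, and these are the labels. Working with graphs avoids functions that are undefined on
  tuples from other components.\<close>

definition disjoint_union :: "nat \<Rightarrow> (nat \<Rightarrow> struct) \<Rightarrow> struct" where
  "disjoint_union k A = \<lparr>universe = {tag j x | j x. j < k \<and> x \<in> universe (A j)},
    rel_arity = (\<lambda>s. let j = fst (prod_decode s)
      in if j < k then graph_arity (A j) (snd (prod_decode s)) else None),
    fun_arity = Map.empty,
    rel_interp = (\<lambda>s. let j = fst (prod_decode s)
      in if j < k then map (tag j) ` graph_interp (A j) (snd (prod_decode s)) else {}),
    fun_interp = (\<lambda>_. Map.empty)\<rparr>"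

lemma disjoint_union_simps [simp]:
  "universe (disjoint_union k A) = {tag j x | j x. j < k \<and> x \<in> universe (A j)}"
  "rel_arity (disjoint_union k A) (prod_encode (j, t)) = (if j < k then graph_arity (A j) t else None)"
  "fun_arity (disjoint_union k A) = Map.empty"
  "rel_interp (disjoint_union k A) (prod_encode (j, t)) =
    (if j < k then map (tag j) ` graph_interp (A j) t else {})"
  by (simp_all add: disjoint_union_def)

lemma wf_disjoint_union:
  assumes wf: "\<And>j. j < k \<Longrightarrow> wf_struct (A j)" and "0 < k"
  shows "wf_struct (disjoint_union k A)"
  unfolding wf_struct_def
proof (intro conjI allI)
  show "universe (disjoint_union k A) \<noteq> {}"
    using wf[OF \<open>0 < k\<close>] \<open>0 < k\<close> by (auto simp: wf_struct_def)
  show "case rel_arity (disjoint_union k A) s of None \<Rightarrow> rel_interp (disjoint_union k A) s = {}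
      | Some n \<Rightarrow> rel_interp (disjoint_union k A) s \<subseteq> tuples (universe (disjoint_union k A)) n" for s
  proof -
    obtain j t where s: "s = prod_encode (j, t)" by (metis prod_decode_inverse surj_pair)
    have "\<exists>n. graph_arity (A j) t = Some n \<and> map (tag j) xs \<in> tuples (universe (disjoint_union k A)) n"
      if "j < k" "xs \<in> graph_interp (A j) t" for xs
      using wf_graph_interp[OF wf[OF that(1)] that(2)] that(1) by (auto simp: tuples_def)
    then show ?thesis by (auto simp: s split: option.split simp del: disjoint_union_simps(1))
  qed
qed (simp add: disjoint_union_def)

text \<open>The programs for the \<open>F j\<close> are hard-wired one by one, without any
  uniformity in \<open>j\<close>. This is where the number of components has to be finite.\<close>

lemma cf_finite_cases:
  assumes "\<And>j. j < k \<Longrightarrow> computes X (F j)" and f: "computes_from X vs f" and g: "computes_from X vs g"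
  shows "computes_from X vs (\<lambda>a. if f a < k then F (f a) (g a) else 0)"
  using assms(1)
proof (induction k)
  case (Suc k)
  have *: "(if f a < Suc k then F (f a) (g a) else 0) =
      (if f a = k then F k (g a) else if f a < k then F (f a) (g a) else 0)" for a
    by (auto simp: less_Suc_eq)
  have "computes X (F k)" using Suc.prems by simp
  then show ?case unfolding * using Suc
    by (intro cf_if[OF cf_eq[OF f cf_const] cf_unary[of X "F k", OF _ g]]) auto
qed (simp add: cf_const)

lemma cf_disjoint_union:
  assumes A: "\<And>j. j < k \<Longrightarrow> computable_struct (A j)" and f: "computes_from X vs f"
  shows "computes_from X vs (\<lambda>a. of_bool (f a \<in> universe (disjoint_union k A)))"
proof -
  have U: "f a \<in> universe (disjoint_union k A) \<longleftrightarrow>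
      fst (prod_decode (f a)) < k \<and> snd (prod_decode (f a)) \<in> universe (A (fst (prod_decode (f a))))" for a
    by simp (metis fst_conv prod.collapse prod_decode_inverse prod_encode_inverse snd_conv)
  have "computes_from X vs (\<lambda>a. if fst (prod_decode (f a)) < k
      then of_bool (snd (prod_decode (f a)) \<in> universe (A (fst (prod_decode (f a))))) else 0)"
  proof (rule cf_finite_cases[where F = "\<lambda>j x. of_bool (x \<in> universe (A j))"])
    show "computes X (\<lambda>x. of_bool (x \<in> universe (A j)))" if "j < k" for j
      unfolding computes_from_single[symmetric] by (intro cf_universe A that) (simp add: cf_var)
  qed (intro cf_fst_decode cf_snd_decode f)+
  moreover have "(if b then of_bool c else 0) = (of_bool (b \<and> c) :: nat)" for b c by simp
  ultimately show ?thesis unfolding U by (simp only:)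
qed

lemma computable_disjoint_union:
  assumes A: "\<And>j. j < k \<Longrightarrow> computable_struct (A j)" and "0 < k"
  shows "computable_struct (disjoint_union k A)"
proof -
  let ?D = "disjoint_union k A"
  have ar: "computable (\<lambda>i. option_encode (rel_arity ?D i))"
  proof -
    have "computes_from {} [\<lambda>i. i] (\<lambda>i. if fst (prod_decode i) < k
        then option_encode (graph_arity (A (fst (prod_decode i))) (snd (prod_decode i))) else 0)"
    proof (rule cf_finite_cases[where F = "\<lambda>j t. option_encode (graph_arity (A j) t)"])
      show "computes {} (\<lambda>t. option_encode (graph_arity (A j) t))" if "j < k" for j
        unfolding computes_from_single[symmetric]
        by (intro cf_graph_arity) (use A[OF that] in \<open>simp_all add: computable_struct_def cf_var\<close>)
    qed (simp_all add: cf_fst_decode cf_snd_decode cf_var)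
    moreover have "(if fst (prod_decode i) < k
        then option_encode (graph_arity (A (fst (prod_decode i))) (snd (prod_decode i))) else 0) =
        option_encode (rel_arity ?D i)" for i
      by (simp add: disjoint_union_def Let_def)
    ultimately show ?thesis by (simp only: computable_def computes_from_single)
  qed
  let ?R = "{prod_encode (s, list_encode xs) | s xs. xs \<in> rel_interp ?D s}"
  let ?j = "\<lambda>z. fst (prod_decode (fst (prod_decode z)))"
  let ?t = "\<lambda>z. snd (prod_decode (fst (prod_decode z)))"
  let ?xs = "\<lambda>z. list_decode (snd (prod_decode z))"
  let ?F = "\<lambda>j z. of_bool (list_all (\<lambda>x. fst (prod_decode x) = j) (?xs z) \<and>
    map (\<lambda>x. snd (prod_decode x)) (?xs z) \<in> graph_interp (A j) (?t z)) :: nat"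
  have untag: "xs \<in> map (tag j) ` S \<longleftrightarrow> list_all (\<lambda>x. fst (prod_decode x) = j) xs \<and>
      map (\<lambda>x. snd (prod_decode x)) xs \<in> S" for xs j S
  proof
    assume *: "list_all (\<lambda>x. fst (prod_decode x) = j) xs \<and> map (\<lambda>x. snd (prod_decode x)) xs \<in> S"
    then have "map (tag j) (map (\<lambda>x. snd (prod_decode x)) xs) = xs"
      by (auto simp: list_all_iff intro!: map_idI)
    then show "xs \<in> map (tag j) ` S" using * by (metis imageI)
  qed (auto simp: list_all_iff comp_def)
  have R: "of_bool (z \<in> ?R) = (if ?j z < k then ?F (?j z) z else 0)" for z
  proof -
    have "z \<in> ?R \<longleftrightarrow> ?xs z \<in> rel_interp ?D (fst (prod_decode z))"
    proof
      assume "?xs z \<in> rel_interp ?D (fst (prod_decode z))"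
      moreover have "z = prod_encode (fst (prod_decode z), list_encode (?xs z))" by simp
      ultimately show "z \<in> ?R" by blast
    qed auto
    then show ?thesis by (simp add: disjoint_union_def Let_def untag)
  qed
  have "computes_from {} [\<lambda>z. z] (\<lambda>z. if ?j z < k then ?F (?j z) z else 0)"
  proof (rule cf_finite_cases[where F = ?F])
    fix j assume "j < k"
    note mem = cf_mem_graph_interp[OF computable_graph_diagram[OF A[OF this]]]
    show "computes {} (?F j)"
      unfolding computes_from_single[symmetric]
      by (intro cf_conj cf_list_all mem cf_map cf_eq cf_const cf_fst_decode cf_snd_decode)
        (simp_all add: cf_var cf_fst_decode cf_snd_decode)
  qed (simp_all add: cf_fst_decode cf_var)
  then have "computable_set ?R"
    by (simp only: R computable_set_def computable_def computes_from_single)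
  moreover have "computable_set (universe ?D)"
    unfolding computable_set_def computable_def computes_from_single[symmetric]
    by (rule cf_disjoint_union[OF A]) (simp_all add: cf_var)
  moreover have "computable (\<lambda>n. case prod_decode n of
      (i, c) \<Rightarrow> option_encode (fun_interp ?D i (list_decode c)))"
    using cf_const[of "{}" "[\<lambda>n. n]" 0]
    by (simp add: disjoint_union_def computable_def computes_from_single case_prod_beta)
  moreover have "computable (\<lambda>i. option_encode (fun_arity ?D i))"
    using cf_const[of "{}" "[\<lambda>n. n]" 0] by (simp add: computable_def computes_from_single)
  ultimately show ?thesis
    unfolding computable_struct_def
    using wf_disjoint_union[of k A] A computable_struct_wf \<open>0 < k\<close> ar by blast
qed

text \<open>Because the label of component \<open>j\<close> is preserved, an isomorphism
  \<open>f\<close> of the unions maps this component onto its counterpart. Restricting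
  \<open>f\<close> and removing the tags is effective.\<close>

lemma IsoSpec_disjoint_union_component:
  assumes A: "\<And>j. j < k \<Longrightarrow> computable_struct (A j)" and B: "\<And>j. j < k \<Longrightarrow> computable_struct (B j)"
    and ar: "\<And>j. j < k \<Longrightarrow> rel_arity (A j) = rel_arity (B j)"
      "\<And>j. j < k \<Longrightarrow> fun_arity (A j) = fun_arity (B j)"
    and d: "d \<in> IsoSpec (disjoint_union k A) (disjoint_union k B)" and j: "j < k"
  shows "d \<in> IsoSpec (A j) (B j)"
proof -
  let ?A = "disjoint_union k A" and ?B = "disjoint_union k B"
  let ?U = "universe (A j)" and ?V = "universe (B j)"
  have wf: "wf_struct ?A" "wf_struct ?B" "wf_struct (A j)" "wf_struct (B j)"
    using computable_disjoint_union[of k A] computable_disjoint_union[of k B] A B j computable_struct_wf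
    by force+
  obtain f where f: "struct_iso f ?A ?B" and df: "degree_computes d f"
    using d unfolding IsoSpec_def by blast
  note iso = f[unfolded struct_iso_relational[OF wf(1) disjoint_union_simps(3) wf(2) disjoint_union_simps(3)]]
  define h where "h = restrict (\<lambda>x. snd (prod_decode (f (tag j x)))) ?U"
  have rel: "xs \<in> rel_interp ?A s \<longleftrightarrow> map f xs \<in> rel_interp ?B s" if "xs \<in> lists (universe ?A)" for xs s
    using iso that by blast
  \<comment> \<open>\<open>prod_encode (0, 0)\<close> is a graph symbol of the universe, so the
    relation on the right is the label of component \<open>j\<close>.\<close>
  have label: "z \<in> tag j ` universe (C j) \<longleftrightarrow> [z] \<in> rel_interp (disjoint_union k C) (prod_encode (j, prod_encode (0, 0)))"
    for z and C :: "nat \<Rightarrow> struct"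
  proof -
    have "graph_interp (C j) (prod_encode (0, 0)) = (\<lambda>x. [x]) ` universe (C j)"
      by (auto simp: graph_interp_def)
    then show ?thesis using j by (auto simp: image_image)
  qed
  have f_tag: "z \<in> tag j ` ?U \<longleftrightarrow> f z \<in> tag j ` ?V" if "z \<in> universe ?A" for z
    unfolding label using rel[of "[z]"] that by (simp del: disjoint_union_simps(4))
  have h: "h x \<in> ?V" "f (tag j x) = tag j (h x)" if "x \<in> ?U" for x
  proof -
    have "tag j x \<in> universe ?A" using that j by auto
    then have "f (tag j x) \<in> tag j ` ?V" using f_tag that by blast
    then show "h x \<in> ?V" "f (tag j x) = tag j (h x)" using that by (auto simp: h_def)
  qed
  have "struct_iso h (A j) (B j)"
    unfolding struct_iso_iff_graph[OF wf(3,4)]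
  proof (intro conjI allI ballI)
    show "bij_betw h ?U ?V"
      unfolding bij_betw_def
    proof
      show "inj_on h ?U"
      proof (rule inj_onI)
        fix x y assume xy: "x \<in> ?U" "y \<in> ?U" "h x = h y"
        then have "f (tag j x) = f (tag j y)" using h(2) by simp
        moreover have "tag j x \<in> universe ?A" "tag j y \<in> universe ?A" using xy j by auto
        ultimately have "tag j x = tag j y"
          using struct_iso_bij[OF f] unfolding bij_betw_def by (meson inj_onD)
        then show "x = y" by (simp add: prod_encode_eq)
      qed
      show "h ` ?U = ?V"
      proof (rule subset_antisym)
        show "?V \<subseteq> h ` ?U"
        proof
          fix y assume y: "y \<in> ?V"
          then have "tag j y \<in> universe ?B" using j by auto
          then obtain z where z: "z \<in> universe ?A" "f z = tag j y"
            using struct_iso_onto[OF f] by blast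
          then have "z \<in> tag j ` ?U" using f_tag y by blast
          then obtain x where "x \<in> ?U" "z = tag j x" by blast
          then show "y \<in> h ` ?U" using z(2) h(2)[of x] by (auto simp: prod_encode_eq)
        qed
      qed (use h in blast)
    qed
    fix t xs assume xs: "xs \<in> lists ?U"
    have "map f (map (tag j) xs) = map (tag j) (map h xs)" using xs h by auto
    moreover have "map (tag j) xs \<in> lists (universe ?A)" using xs j by auto
    ultimately have "map (tag j) xs \<in> rel_interp ?A (prod_encode (j, t)) \<longleftrightarrow>
        map (tag j) (map h xs) \<in> rel_interp ?B (prod_encode (j, t))"
      using rel by metis
    then show "xs \<in> graph_interp (A j) t \<longleftrightarrow> map h xs \<in> graph_interp (B j) t"
      using j by (auto simp: image_iff map_tag_eq_iff simp del: map_map)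
  qed (use ar j in \<open>auto simp: h_def\<close>)
  moreover have "degree_computes d h"
    using df
  proof (induction d rule: turing_degree.abs_induct)
    fix X assume "degree_computes (abs_turing_degree X) f"
    then have f: "computes X f" by (simp add: degree_computes.abs_eq)
    have "computes_from X [\<lambda>x. x] (\<lambda>x. if x \<in> ?U then snd (prod_decode (f (tag j x))) else undefined)"
      by (intro cf_if cf_universe[OF A[OF j]] cf_snd_decode cf_unary[OF f] cf_prod_encode cf_const)
        (simp_all add: cf_var)
    then show "degree_computes (abs_turing_degree X) h"
      by (simp only: degree_computes.abs_eq computes_from_single h_def restrict_def)
  qed
  ultimately show ?thesis unfolding IsoSpec_def by blast
qed

text \<open>A copy \<open>C\<close> of the union falls into the images of the components under
  \<open>g\<close>. The graph relations of piece \<open>j\<close> are exactly the relations of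
  \<open>C\<close> with symbols \<open>(j, t)\<close>, so the piece is computable because
  \<open>C\<close> is; the complexity of \<open>g\<close> does not enter.\<close>

lemma disjoint_union_copy_component:
  assumes B: "\<And>j. j < k \<Longrightarrow> computable_struct (B j)" and C: "computable_struct C"
    and g: "struct_iso g (disjoint_union k B) C" and j: "j < k"
  defines "Cj \<equiv> image_struct (\<lambda>x. g (tag j x)) (B j)"
  shows "inj_on (\<lambda>x. g (tag j x)) (universe (B j))"
    and "graph_interp Cj t = rel_interp C (prod_encode (j, t))"
    and "Cj \<in> computable_copies (B j)"
proof -
  let ?D = "disjoint_union k B" and ?h = "\<lambda>x. g (tag j x)"
  have wf: "wf_struct ?D" "wf_struct (B j)" "wf_struct C"
    using computable_disjoint_union[of k B] B C j computable_struct_wf by force+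
  have fun_C: "fun_arity C = Map.empty" using struct_iso_fun_arity[OF g] by simp
  note g' = g[unfolded struct_iso_relational[OF wf(1) disjoint_union_simps(3) wf(3) fun_C]]
  have tag_in: "tag j x \<in> universe ?D" if "x \<in> universe (B j)" for x using that j by auto
  show inj: "inj_on ?h (universe (B j))"
  proof (rule inj_onI)
    fix x y assume xy: "x \<in> universe (B j)" "y \<in> universe (B j)" "?h x = ?h y"
    then have "tag j x = tag j y"
      using struct_iso_bij[OF g] tag_in unfolding bij_betw_def by (meson inj_onD)
    then show "x = y" by (simp add: prod_encode_eq)
  qed
  show interp: "graph_interp Cj t = rel_interp C (prod_encode (j, t))" for t
  proof -
    have rel_D: "rel_interp ?D (prod_encode (j, t)) = map (tag j) ` graph_interp (B j) t" using j by simp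
    have "rel_interp C (prod_encode (j, t)) = map g ` rel_interp ?D (prod_encode (j, t))"
    proof
      show "rel_interp C (prod_encode (j, t)) \<subseteq> map g ` rel_interp ?D (prod_encode (j, t))"
      proof
        fix ys assume ys: "ys \<in> rel_interp C (prod_encode (j, t))"
        then have "set ys \<subseteq> g ` universe ?D"
          using wf_rel_interp[OF wf(3)] bij_betw_imp_surj_on[OF struct_iso_bij[OF g]]
          unfolding tuples_def by blast
        then obtain xs where xs: "xs \<in> lists (universe ?D)" "ys = map g xs"
          by (metis in_listsI lists_image image_iff lists_eq_set mem_Collect_eq)
        then show "ys \<in> map g ` rel_interp ?D (prod_encode (j, t))" using g' ys by blast
      qed
      have "rel_interp ?D (prod_encode (j, t)) \<subseteq> lists (universe ?D)"
        using wf_rel_interp[OF wf(1)] unfolding tuples_def by blast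
      then show "map g ` rel_interp ?D (prod_encode (j, t)) \<subseteq> rel_interp C (prod_encode (j, t))"
        using g' by blast
    qed
    then show ?thesis
      unfolding Cj_def graph_interp_image_struct[OF wf(2) inj] rel_D by (simp add: image_image comp_def)
  qed
  have D: "z \<in> graph_diagram Cj \<longleftrightarrow> prod_encode (tag j (fst (prod_decode z)), snd (prod_decode z)) \<in>
      {prod_encode (s, list_encode xs) | s xs. xs \<in> rel_interp C s}" (is "_ \<longleftrightarrow> _ \<in> ?R") for z
  proof -
    have "prod_encode (s, list_encode xs) \<in> ?R \<longleftrightarrow> xs \<in> rel_interp C s" for s xs
      by (auto simp: prod_encode_eq list_encode_eq)
    from this[of _ "list_decode c" for c] show ?thesis
      by (simp add: mem_graph_diagram_iff interp)
  qed
  have R: "computes {} (\<lambda>n. of_bool (n \<in> {prod_encode (s, list_encode xs) | s xs. xs \<in> rel_interp C s}))"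
    using C by (simp add: computable_struct_def computable_set_def computable_def)
  have "computable_set (graph_diagram Cj)"
    unfolding computable_set_def computable_def computes_from_single[symmetric] D
    by (intro cf_unary[OF R] cf_prod_encode cf_const cf_fst_decode cf_snd_decode) (simp_all add: cf_var)
  moreover have "rel_arity Cj = rel_arity (B j)" "fun_arity Cj = fun_arity (B j)" by (simp_all add: Cj_def)
  ultimately have "computable_struct Cj"
    using B[OF j] wf_image_struct[OF wf(2) inj]
    by (intro computable_struct_if_graph_diagram) (simp_all add: Cj_def computable_struct_def)
  then show "Cj \<in> computable_copies (B j)"
    using struct_iso_image_struct[OF wf(2) inj]
    unfolding computable_copies_def isomorphic_def Cj_def by blast
qed

text \<open>Isomorphisms onto the pieces are glued together. The map \<open>g\<close> only
  determines what the pieces are and need not be computable in \<open>d\<close>; its injectivity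
  keeps them disjoint.\<close>

lemma IsoSpec_disjoint_union:
  assumes A: "\<And>j. j < k \<Longrightarrow> computable_struct (A j)" and B: "\<And>j. j < k \<Longrightarrow> computable_struct (B j)"
    and C: "computable_struct C" and g: "struct_iso g (disjoint_union k B) C" and k: "0 < k"
    and d: "\<And>j. j < k \<Longrightarrow> d \<in> IsoSpec (A j) (image_struct (\<lambda>x. g (tag j x)) (B j))"
  shows "d \<in> IsoSpec (disjoint_union k A) C"
proof -
  let ?A = "disjoint_union k A" and ?B = "disjoint_union k B"
  let ?C = "\<lambda>j. image_struct (\<lambda>x. g (tag j x)) (B j)"
  have "\<exists>f. struct_iso f (A j) (?C j) \<and> degree_computes d f" if "j < k" for j
    using d[OF that] unfolding IsoSpec_def by blast
  then obtain f where f: "\<And>j. j < k \<Longrightarrow> struct_iso (f j) (A j) (?C j)"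
    and df: "\<And>j. j < k \<Longrightarrow> degree_computes d (f j)" by metis
  have wf: "wf_struct ?A" "wf_struct ?B" "wf_struct C"
    using computable_disjoint_union[of k A] computable_disjoint_union[of k B] A B C k computable_struct_wf
    by force+
  have wf_A: "wf_struct (A j)" and wf_C: "wf_struct (?C j)" if "j < k" for j
    using A[OF that] disjoint_union_copy_component(3)[OF B C g that] computable_struct_wf
    unfolding computable_copies_def by auto
  note interp = disjoint_union_copy_component(2)[OF B C g]
  have fun_C: "fun_arity C = Map.empty" using struct_iso_fun_arity[OF g] by simp
  define F where "F = restrict (\<lambda>z. f (fst (prod_decode z)) (snd (prod_decode z))) (universe ?A)"
  have F: "F (tag j x) = f j x" if "j < k" "x \<in> universe (A j)" for j x
    using that by (auto simp: F_def)
  have F_in: "F (tag j x) \<in> universe (?C j)" if "j < k" "x \<in> universe (A j)" for j x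
    using struct_iso_in[OF f] that by (simp add: F)
  have disj: "i = j" if i: "i < k" "y \<in> universe (?C i)" and j: "j < k" "y \<in> universe (?C j)" for i j y
  proof -
    obtain x x' where x: "x \<in> universe (B i)" "x' \<in> universe (B j)" "g (tag i x) = y" "g (tag j x') = y"
      using i(2) j(2) by auto
    have "tag i x \<in> universe ?B" "tag j x' \<in> universe ?B" using x i(1) j(1) by auto
    then have "tag i x = tag j x'"
      using struct_iso_bij[OF g] x(3,4) unfolding bij_betw_def by (metis inj_onD)
    then show ?thesis by (simp add: prod_encode_eq)
  qed
  have U_C: "y \<in> universe C \<longleftrightarrow> (\<exists>j<k. y \<in> universe (?C j))" for y
    unfolding bij_betw_imp_surj_on[OF struct_iso_bij[OF g], symmetric] by auto
  have "struct_iso F ?A C"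
    unfolding struct_iso_relational[OF wf(1) disjoint_union_simps(3) wf(3) fun_C]
  proof (intro conjI allI ballI)
    show "F \<in> extensional (universe ?A)" by (simp add: F_def)
    show "bij_betw F (universe ?A) (universe C)"
      unfolding bij_betw_def
    proof
      show "inj_on F (universe ?A)"
      proof (rule inj_onI)
        fix z z' assume zz: "z \<in> universe ?A" "z' \<in> universe ?A" "F z = F z'"
        then obtain i x j y where ij: "z = tag i x" "i < k" "x \<in> universe (A i)"
          "z' = tag j y" "j < k" "y \<in> universe (A j)" by auto
        have "i = j" using disj[of i "F z" j] F_in ij zz(3) by metis
        then have "f i x = f i y" using zz(3) ij F by metis
        then have "x = y"
          using struct_iso_bij[OF f[OF ij(2)]] ij \<open>i = j\<close> unfolding bij_betw_def by (metis inj_onD)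
        then show "z = z'" using ij \<open>i = j\<close> by simp
      qed
      show "F ` universe ?A = universe C"
      proof
        show "F ` universe ?A \<subseteq> universe C" using F_in U_C by fastforce
        show "universe C \<subseteq> F ` universe ?A"
        proof
          fix y assume "y \<in> universe C"
          then obtain j where j: "j < k" "y \<in> universe (?C j)" using U_C by blast
          then obtain x where x: "x \<in> universe (A j)" "f j x = y" using struct_iso_onto[OF f[OF j(1)]] by blast
          then have "y = F (tag j x)" "tag j x \<in> universe ?A" using j(1) F by auto
          then show "y \<in> F ` universe ?A" by blast
        qed
      qed
    qed
    have graph_ar: "graph_arity (A j) = graph_arity (B j)" if "j < k" for j
      using struct_iso_rel_arity[OF f[OF that]] struct_iso_fun_arity[OF f[OF that]]
      by (intro graph_arity_eqI) simp_all
    have "rel_arity ?A s = rel_arity ?B s" for s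
      using graph_ar by (simp add: disjoint_union_def Let_def)
    then show "rel_arity ?A = rel_arity C" using struct_iso_rel_arity[OF g] by (metis ext)
    fix s xs assume xs: "xs \<in> lists (universe ?A)"
    obtain j t where s: "s = prod_encode (j, t)" by (metis prod_decode_inverse surj_pair)
    show "xs \<in> rel_interp ?A s \<longleftrightarrow> map F xs \<in> rel_interp C s"
    proof (cases "j < k")
      case False
      then have "rel_arity C s = None"
        using struct_iso_rel_arity[OF g] by (metis disjoint_union_simps(2) s)
      then have "rel_interp C s = {}" using wf_rel_interp[OF wf(3)] by fastforce
      then show ?thesis using False by (simp add: s)
    next
      case j: True
      show ?thesis
      proof (cases "set xs \<subseteq> tag j ` universe (A j)")
        case True
        then have "xs \<in> map (tag j) ` lists (universe (A j))" by (auto simp flip: lists_image)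
        then obtain ys where ys: "xs = map (tag j) ys" "ys \<in> lists (universe (A j))" by blast
        have "map F xs = map (f j) ys" using ys j F by auto
        moreover have "ys \<in> graph_interp (A j) t \<longleftrightarrow> map (f j) ys \<in> graph_interp (?C j) t"
          using f[OF j] ys(2) unfolding struct_iso_iff_graph[OF wf_A[OF j] wf_C[OF j]] by blast
        ultimately show ?thesis
          using j ys(1) interp[OF _ j] by (auto simp: s image_iff map_tag_eq_iff simp del: map_map)
      next
        \<comment> \<open>An entry from another component \<open>i\<close> keeps the list out of
          every relation labelled \<open>j\<close>. Its image under \<open>F\<close> lies in piece
          \<open>i\<close>, so the same holds for the image of the list.\<close>
        case False
        then obtain z where z: "z \<in> set xs" "z \<notin> tag j ` universe (A j)" by blast
        moreover have "z \<in> universe ?A" using xs z(1) by blast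
        ultimately obtain i x where ix: "z = tag i x" "i < k" "i \<noteq> j" "x \<in> universe (A i)" by auto
        then have "F z \<notin> universe (?C j)" using disj[OF ix(2) F_in[OF ix(2,4)] j] by blast
        then have "map F xs \<notin> graph_interp (?C j) t"
          using z(1) graph_interp_subset_lists[OF wf_C[OF j], of t] by fastforce
        moreover have "xs \<notin> rel_interp ?A s"
          using z j graph_interp_subset_lists[OF wf_A[OF j], of t] by (fastforce simp: s)
        ultimately show ?thesis using interp[OF _ j] by (simp add: s)
      qed
    qed
  qed
  moreover have "degree_computes d F"
    using df
  proof (induction d rule: turing_degree.abs_induct)
    fix X assume "\<And>j. j < k \<Longrightarrow> degree_computes (abs_turing_degree X) (f j)"
    then have f: "computes X (f j)" if "j < k" for j using that by (simp add: degree_computes.abs_eq)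
    have "computes_from X [\<lambda>z. z] (\<lambda>z. if z \<in> universe ?A
        then if fst (prod_decode z) < k then f (fst (prod_decode z)) (snd (prod_decode z)) else 0
        else undefined)"
      by (intro cf_if[where f = "\<lambda>z. if _ z then _ z else _ z"] cf_disjoint_union A cf_finite_cases f cf_const)
        (simp_all add: cf_var cf_fst_decode cf_snd_decode)
    moreover have "(if z \<in> universe ?A
        then if fst (prod_decode z) < k then f (fst (prod_decode z)) (snd (prod_decode z)) else 0
        else undefined) = F z" for z
      by (auto simp: F_def)
    ultimately show "degree_computes (abs_turing_degree X) F"
      by (simp only: degree_computes.abs_eq computes_from_single)
  qed
  ultimately show ?thesis unfolding IsoSpec_def by blast
qed


section \<open>Spectral dimension\<close>

lemma cardinality_eq_0_iff: "cardinality X = 0 \<longleftrightarrow> X = {}"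
  by (auto simp: cardinality_def zero_enat_def)

lemma spectral_dimension_eq_1I:
  assumes M: "computable_struct M" and A: "A \<in> computable_copies M" and B: "B \<in> computable_copies M"
    and eq: "CatSpec M = IsoSpec A B"
  shows "spectral_dimension M = 1"
  unfolding spectral_dimension_def
proof (rule Least_equality)
  obtain P where P: "lists_copy_pairs P M" using ex_lists_copy_pairs[OF M] by blast
  then have "(A, B) \<in> range P" using A B by (simp add: lists_copy_pairs_def)
  then obtain i where "P i = (A, B)" by force
  then show "\<exists>P X. lists_copy_pairs P M \<and> X \<noteq> {} \<and> cardinality X = 1 \<and>
      CatSpec M = (\<Inter>i\<in>X. IsoSpec (fst (P i)) (snd (P i)))"
    using P eq by (intro exI[of _ P] exI[of _ "{i}"]) (simp add: cardinality_def one_enat_def)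
  show "1 \<le> k" if "\<exists>P X. lists_copy_pairs P M \<and> X \<noteq> {} \<and> cardinality X = k \<and>
      CatSpec M = (\<Inter>i\<in>X. IsoSpec (fst (P i)) (snd (P i)))" for k
    using that cardinality_eq_0_iff by (metis ileI1 one_eSuc zero_less_iff_neq_zero)
qed

lemma copies_arities:
  "A \<in> computable_copies M \<Longrightarrow> rel_arity A = rel_arity M \<and> fun_arity A = fun_arity M"
  unfolding computable_copies_def isomorphic_def
  using struct_iso_rel_arity struct_iso_fun_arity by fastforce

lemma computable_copies_trans:
  assumes M: "computable_struct M" and A: "A \<in> computable_copies M" and B: "B \<in> computable_copies A"
  shows "B \<in> computable_copies M"
  using assms isomorphic_trans[of M A B] computable_struct_wf unfolding computable_copies_def by blast

text \<open>The witness is the union of the \<open>A j\<close>. A degree above \<open>d\<close>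
  reaches every copy of it, because the pieces of the copy are copies of \<open>M\<close>.
  Conversely, a degree in \<open>IsoSpec ?A ?B\<close> lies in each
  \<open>IsoSpec (A j) (B j)\<close>, hence above \<open>d\<close>. So the single pair
  \<open>?A\<close>, \<open>?B\<close> already cuts out the cone.\<close>

lemma strong_if_finite_Inter:
  fixes k :: nat
  assumes M: "computable_struct M" and d: "degree_of_categoricity M d" and k: "0 < k"
    and A: "\<And>j. j < k \<Longrightarrow> A j \<in> computable_copies M" and B: "\<And>j. j < k \<Longrightarrow> B j \<in> computable_copies M"
    and Inter: "CatSpec M = (\<Inter>j<k. IsoSpec (A j) (B j))"
  shows "\<exists>N. computable_struct N \<and> strong_degree_of_categoricity N d"
proof -
  let ?A = "disjoint_union k A" and ?B = "disjoint_union k B"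
  have cone: "CatSpec M = {d..}" using d by (simp add: degree_of_categoricity_def)
  have comp_A: "computable_struct (A j)" and comp_B: "computable_struct (B j)" if "j < k" for j
    using A[OF that] B[OF that] by (simp_all add: computable_copies_def)
  have comp: "computable_struct ?A" "computable_struct ?B"
    using computable_disjoint_union k comp_A comp_B by blast+
  \<comment> \<open>Stated for copies of \<open>?B\<close>, not of \<open>?A\<close>: the instance
    \<open>C = ?B\<close> yields the isomorphism of the two unions, and from then on copies of
    \<open>?A\<close> are copies of \<open>?B\<close>.\<close>
  have above: "c \<in> IsoSpec ?A C" if c: "d \<le> c" and C: "computable_struct C" "isomorphic ?B C" for c C
  proof -
    obtain g where g: "struct_iso g ?B C" using C(2) by (auto simp: isomorphic_def)
    have "c \<in> IsoSpec (A j) (image_struct (\<lambda>x. g (tag j x)) (B j))" if "j < k" for j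
    proof (rule IsoSpec_if_CatSpec[OF M _ A[OF that]])
      show "c \<in> CatSpec M" using c cone by simp
      show "image_struct (\<lambda>x. g (tag j x)) (B j) \<in> computable_copies M"
        using computable_copies_trans[OF M B[OF that]]
          disjoint_union_copy_component(3)[OF comp_B C(1) g that] by blast
    qed
    then show ?thesis by (intro IsoSpec_disjoint_union[OF _ _ C(1) g k]) (simp_all add: comp_A comp_B)
  qed
  have below: "c \<in> {d..}" if "c \<in> IsoSpec ?A ?B" for c
  proof -
    have "c \<in> IsoSpec (A j) (B j)" if "j < k" for j
      using IsoSpec_disjoint_union_component[OF comp_A comp_B _ _ \<open>c \<in> IsoSpec ?A ?B\<close> that]
        copies_arities[OF A] copies_arities[OF B] by simp
    then show ?thesis using Inter cone by blast
  qed
  have "d \<in> IsoSpec ?A ?B"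
    using above[OF order_refl comp(2)] isomorphic_refl computable_struct_wf comp(2) by blast
  then have iso: "isomorphic ?A ?B" by (auto simp: IsoSpec_def isomorphic_def)
  then have B_copy: "?B \<in> computable_copies ?A" using comp by (simp add: computable_copies_def)
  have A_copy: "?A \<in> computable_copies ?A"
    using comp(1) isomorphic_refl computable_struct_wf by (simp add: computable_copies_def)
  have "{d..} \<subseteq> CatSpec ?A"
  proof
    fix c assume c: "c \<in> {d..}"
    have "c \<in> IsoSpec ?A C" if "C \<in> computable_copies ?A" for C
    proof (rule above)
      show "computable_struct C" using that by (simp add: computable_copies_def)
      note wf = computable_struct_wf[OF comp(2)] computable_struct_wf[OF comp(1)]
        computable_struct_wf[OF \<open>computable_struct C\<close>]
      have "isomorphic ?A C" using that by (simp add: computable_copies_def)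
      with isomorphic_sym[OF wf(2,1) iso] show "isomorphic ?B C" by (rule isomorphic_trans[OF wf])
    qed (use c in simp)
    then show "c \<in> CatSpec ?A" by (simp add: CatSpec_def computably_categorical_def)
  qed
  moreover have "CatSpec ?A \<subseteq> IsoSpec ?A ?B"
    using B_copy by (auto simp: CatSpec_def computably_categorical_def)
  moreover have "IsoSpec ?A ?B \<subseteq> {d..}" using below by blast
  ultimately have "CatSpec ?A = {d..}" "CatSpec ?A = IsoSpec ?A ?B" by blast+
  then have "strong_degree_of_categoricity ?A d"
    using spectral_dimension_eq_1I[OF comp(1) A_copy B_copy]
    by (simp add: strong_degree_of_categoricity_def degree_of_categoricity_def)
  then show ?thesis using comp(1) by blast
qed

section \<open>The three conclusions\<close>

lemma self_copy: "computable_struct M \<Longrightarrow> M \<in> computable_copies M"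
  by (simp add: computable_copies_def isomorphic_refl computable_struct_wf)

theorem theoremA:
  fixes d :: turing_degree and M :: struct
  assumes "computable_struct M"
    and "degree_of_categoricity M d"
    and "\<not> (\<exists>N. computable_struct N \<and> strong_degree_of_categoricity N d)"
  shows "spectral_dimension M = \<infinity> \<and>
    infinite (carrier (AutGroup M)) \<and>
    (\<exists>A\<in>computable_copies M. \<exists>B\<in>computable_copies M. \<not> finitely_generated (IsoSpec A B))"
proof -
  note M = assms(1) and d = assms(2)
  have not_finite: "CatSpec M \<noteq> (\<Inter>i\<in>X. IsoSpec (A i) (B i))"
    if X: "finite X" "X \<noteq> {}" and A: "\<And>i. i \<in> X \<Longrightarrow> A i \<in> computable_copies M"
      and B: "\<And>i. i \<in> X \<Longrightarrow> B i \<in> computable_copies M" for X :: "nat set" and A B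
  proof
    assume eq: "CatSpec M = (\<Inter>i\<in>X. IsoSpec (A i) (B i))"
    \<comment> \<open>A disjoint union is indexed by an initial segment, so the finite set
      \<open>X\<close> is enumerated first.\<close>
    obtain e where e: "bij_betw e {..<card X} X"
      using ex_bij_betw_nat_finite[OF X(1)] by (auto simp: atLeast0LessThan)
    have "CatSpec M = (\<Inter>j<card X. IsoSpec (A (e j)) (B (e j)))"
    proof -
      have "(\<Inter>i\<in>e ` {..<card X}. IsoSpec (A i) (B i)) = (\<Inter>j<card X. IsoSpec (A (e j)) (B (e j)))"
        by simp
      then show ?thesis unfolding eq bij_betw_imp_surj_on[OF e] .
    qed
    moreover have "e j \<in> X" if "j < card X" for j using bij_betw_apply[OF e] that by simp
    ultimately show False
      using strong_if_finite_Inter[OF M d, of "card X" "A \<circ> e" "B \<circ> e"] X A B assms(3)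
      by (auto simp: card_gt_0_iff)
  qed
  have dim: "spectral_dimension M = \<infinity>"
  proof -
    let ?Q = "\<lambda>k. \<exists>P X. lists_copy_pairs P M \<and> X \<noteq> {} \<and> cardinality X = k \<and>
      CatSpec M = (\<Inter>i\<in>X. IsoSpec (fst (P i)) (snd (P i)))"
    obtain P where P: "lists_copy_pairs P M" using ex_lists_copy_pairs[OF M] by blast
    \<comment> \<open>All pairs of copies together form an admissible intersection. Hence the least
      dimension is attained by some index set, and that set cannot be finite.\<close>
    have "CatSpec M = (\<Inter>i. IsoSpec (fst (P i)) (snd (P i)))"
    proof
      have "fst (P i) \<in> computable_copies M" "snd (P i) \<in> computable_copies M" for i
        using P rangeI[of P i] unfolding lists_copy_pairs_def by (metis mem_Times_iff)+
      then show "CatSpec M \<subseteq> (\<Inter>i. IsoSpec (fst (P i)) (snd (P i)))"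
        using IsoSpec_if_CatSpec[OF M] by blast
      show "(\<Inter>i. IsoSpec (fst (P i)) (snd (P i))) \<subseteq> CatSpec M"
      proof
        fix c assume c: "c \<in> (\<Inter>i. IsoSpec (fst (P i)) (snd (P i)))"
        have "c \<in> IsoSpec M B" if "B \<in> computable_copies M" for B
        proof -
          have "(M, B) \<in> range P" using P self_copy[OF M] that by (simp add: lists_copy_pairs_def)
          then obtain i where i: "P i = (M, B)" by force
          have "c \<in> IsoSpec (fst (P i)) (snd (P i))" using c by blast
          then show ?thesis by (simp add: i)
        qed
        then show "c \<in> CatSpec M" by (simp add: CatSpec_def computably_categorical_def)
      qed
    qed
    then have "?Q (cardinality UNIV)" using P by blast
    then have "?Q (spectral_dimension M)"
      unfolding spectral_dimension_def by (rule LeastI)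
    then obtain P X where P: "lists_copy_pairs P M" and X: "X \<noteq> {}" "cardinality X = spectral_dimension M"
      and eq: "CatSpec M = (\<Inter>i\<in>X. IsoSpec (fst (P i)) (snd (P i)))" by blast
    have "fst (P i) \<in> computable_copies M" "snd (P i) \<in> computable_copies M" for i
      using P rangeI[of P i] unfolding lists_copy_pairs_def by (metis mem_Times_iff)+
    then have "infinite X" using not_finite[of X "fst \<circ> P" "snd \<circ> P"] X(1) eq by auto
    then show ?thesis using X(2) by (simp add: cardinality_def)
  qed
  have not_fg: "\<exists>A\<in>computable_copies M. \<exists>B\<in>computable_copies M. \<not> finitely_generated (IsoSpec A B)"
  proof (rule ccontr)
    assume no: "\<not> ?thesis"
    have "computable_copies M \<noteq> {}" using self_copy[OF M] by blast
    moreover have "countable (computable_copies M)"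
      by (rule countable_subset[OF _ countable_computable_struct]) (auto simp: computable_copies_def)
    ultimately have range: "range (from_nat_into (computable_copies M)) = computable_copies M"
      by (rule range_from_nat_into)
    let ?B = "from_nat_into (computable_copies M)"
    have B: "?B i \<in> computable_copies M" for i using range by blast
    have cat: "CatSpec M = (\<Inter>i. IsoSpec M (?B i))"
    proof -
      have "CatSpec M = (\<Inter>B\<in>computable_copies M. IsoSpec M B)"
        by (auto simp: CatSpec_def computably_categorical_def)
      then show ?thesis by (subst (asm) range[symmetric]) simp
    qed
    then have "(\<Inter>i. IsoSpec M (?B i)) = {d..}" using d by (simp add: degree_of_categoricity_def)
    then obtain n where "(\<Inter>i<n. IsoSpec M (?B i)) = {d..}"
      using cone_eq_finite_Inter[of "\<lambda>i. IsoSpec M (?B i)" d] no self_copy[OF M] B by blast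
    then have "(\<Inter>i<n. IsoSpec M (?B i)) = CatSpec M" using d by (simp add: degree_of_categoricity_def)
    \<comment> \<open>\<open>n\<close> may be 0, but \<open>not_finite\<close> wants a nonempty
      index set. One more set changes nothing, as the intersection already equals
      \<open>CatSpec M\<close>.\<close>
    moreover have "(\<Inter>i<Suc n. IsoSpec M (?B i)) \<subseteq> (\<Inter>i<n. IsoSpec M (?B i))" by fastforce
    moreover have "CatSpec M \<subseteq> (\<Inter>i<Suc n. IsoSpec M (?B i))" unfolding cat by blast
    ultimately have "CatSpec M = (\<Inter>i<Suc n. IsoSpec M (?B i))" by blast
    then show False using not_finite[of "{..<Suc n}" "\<lambda>_. M" ?B] B self_copy[OF M] by auto
  qed
  have "infinite {f. struct_iso f M M}"
  proof
    assume fin: "finite {f. struct_iso f M M}"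
    have "finitely_generated (IsoSpec A B)"
      if "A \<in> computable_copies M" "B \<in> computable_copies M" for A B
      using that M computable_struct_wf fin
      by (intro finitely_generated_IsoSpec finite_isos_if_finite_automorphisms[of M A B])
        (auto simp: computable_copies_def)
    then show False using not_fg by blast
  qed
  then show ?thesis using dim not_fg by (simp add: AutGroup_def)
qed

end
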